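(* Let $1<r<\infty$ and let $w=uv^{1/r}$ be a weight on $\mathbb{R}$ in $RH_r$ with $u\in RH_\infty$ and $v\in A_1$. Let $c_1=RH_\infty(u)$. Then $w\in A_p$ for all $p>c_1$. Moreover, this range of $p$'s is best possible on $\mathbb{R}_+$: for every $1<r<\infty$ and every $c_1>1$ there are weights $u\in RH_\infty$ and $v\in A_1$ on $\mathbb{R}_+$ with $RH_\infty(u)=c_1$ and $w=uv^{1/r}\in RH_r$ (all conditions taken over intervals $I\subset\mathbb{R}_+$) such that $w\notin A_p$ on $\mathbb{R}_+$ for every $1<p\le c_1$.
   Context: Let $X$ be $\mathbb{R}$ or $\mathbb{R}_+=(0,\infty)$. A weight on $X$ is a positive function integrable on every bounded interval $I\subset X$. Below $I$ denotes an arbitrary bounded interval contained in $X$, $|I|$ is its length, and $\sup_I,\inf_I$ mean essential supremum and infimum over $I$. For $1<p<\infty$ with $p'=p/(p-1)$, $w\in A_p$ iff there is $C<\infty$ with $\frac{1}{|I|}\int_I w\left(\frac{1}{|I|}\int_I w^{1-p'}\right)^{p-1}\le C$ for all $I$. For $1<r<\infty$, $w\in RH_r$ iff there is $C<\infty$ with $\left(\frac{1}{|I|}\int_I w^r\right)^{1/r}\le C\,\frac{1}{|I|}\int_I w$ for all $I$. $w\in A_1$ iff there is $c<\infty$ with $\frac{1}{|I|}\int_I w\le c\inf_I w$ for all $I$. $w\in RH_\infty$ iff there is $c<\infty$ with $\sup_I w\le c\,\frac{1}{|I|}\int_I w$ for all $I$; $RH_\infty(w)$ denotes the infimum of all such constants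 $c$. *)

theory Defs
  imports "HOL-Analysis.Analysis" "HOL-Probability.Essential_Supremum"
begin

text \<open>
  Intervals may be open, closed or half-open. Those of length 0 are excluded, since averages
  divide by the length.
\<close>

definition bounded_interval_in :: "real set \<Rightarrow> real set \<Rightarrow> bool" where
  "bounded_interval_in X I \<longleftrightarrow> is_interval I \<and> bounded I \<and> I \<subseteq> X \<and> 0 < emeasure lebesgue I"

definition weight_on :: "real set \<Rightarrow> (real \<Rightarrow> real) \<Rightarrow> bool" where
  "weight_on X w \<longleftrightarrow>
     (\<forall>x\<in>X. 0 < w x) \<and> (\<forall>I. bounded_interval_in X I \<longrightarrow> set_integrable lebesgue I w)"

text \<open>
  Averages take values in \<open>[0,\<infinity>]\<close>: for a weight \<open>w\<close> the functions \<open>w powr r\<close> and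
  \<open>w powr (1 - p')\<close> need not be locally integrable, and then their averages must be \<open>\<infinity>\<close>,
  whereas the Bochner integral would be 0.
\<close>

definition average :: "real set \<Rightarrow> (real \<Rightarrow> real) \<Rightarrow> ennreal" where
  "average I f = (\<integral>\<^sup>+x\<in>I. ennreal (f x) \<partial>lebesgue) / emeasure lebesgue I"

text \<open>Powers on \<open>[0,\<infinity>]\<close>; used only with positive exponents, whence the value \<open>\<infinity>\<close> at \<open>\<infinity>\<close>.\<close>

definition ennreal_powr :: "ennreal \<Rightarrow> real \<Rightarrow> ennreal" where
  "ennreal_powr x a = (if x = \<infinity> then \<infinity> else ennreal (enn2real x powr a))"

text \<open>The counterpart of \<^const>\<open>esssup\<close>.\<close>

definition essinf :: "'a measure \<Rightarrow> ('a \<Rightarrow> ennreal) \<Rightarrow> ennreal" where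
  "essinf M f = (if f \<in> borel_measurable M then Liminf (ae_filter M) f else bot)"

definition esssup_on :: "real set \<Rightarrow> (real \<Rightarrow> real) \<Rightarrow> ennreal" where
  "esssup_on I w = esssup (lebesgue_on I) (\<lambda>x. ennreal (w x))"

definition essinf_on :: "real set \<Rightarrow> (real \<Rightarrow> real) \<Rightarrow> ennreal" where
  "essinf_on I w = essinf (lebesgue_on I) (\<lambda>x. ennreal (w x))"

text \<open>Below, the exponent \<open>1 - p / (p - 1)\<close> is \<open>1 - p'\<close> for the conjugate exponent \<open>p'\<close> of \<open>p\<close>.\<close>

definition A_class :: "real set \<Rightarrow> real \<Rightarrow> (real \<Rightarrow> real) set" where
  "A_class X p = {w. weight_on X w \<and>
     (\<exists>C::real. \<forall>I. bounded_interval_in X I \<longrightarrow>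
        average I w * ennreal_powr (average I (\<lambda>x. w x powr (1 - p / (p - 1)))) (p - 1)
          \<le> ennreal C)}"

definition RH_class :: "real set \<Rightarrow> real \<Rightarrow> (real \<Rightarrow> real) set" where
  "RH_class X r = {w. weight_on X w \<and>
     (\<exists>C::real. \<forall>I. bounded_interval_in X I \<longrightarrow>
        ennreal_powr (average I (\<lambda>x. w x powr r)) (1 / r) \<le> ennreal C * average I w)}"

definition A1_class :: "real set \<Rightarrow> (real \<Rightarrow> real) set" where
  "A1_class X = {w. weight_on X w \<and>
     (\<exists>c::real. \<forall>I. bounded_interval_in X I \<longrightarrow>
        average I w \<le> ennreal c * essinf_on I w)}"

definition RHinf_constants :: "real set \<Rightarrow> (real \<Rightarrow> real) \<Rightarrow> real set" where
  "RHinf_constants X w =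
     {c. \<forall>I. bounded_interval_in X I \<longrightarrow> esssup_on I w \<le> ennreal c * average I w}"

definition RHinf_class :: "real set \<Rightarrow> (real \<Rightarrow> real) set" where
  "RHinf_class X = {w. weight_on X w \<and> RHinf_constants X w \<noteq> {}}"

text \<open>
  Meaningful for \<open>w \<in> RHinf_class X\<close> with \<open>X\<close> containing a nondegenerate interval: the set of
  constants is then nonempty and bounded below by 1.
\<close>

definition RHinf_const :: "real set \<Rightarrow> (real \<Rightarrow> real) \<Rightarrow> real" where
  "RHinf_const X w = Inf (RHinf_constants X w)"

end

theory Submission
  imports Defs "HOL-Real_Asymp.Real_Asymp"
begin

text \<open>
  Suppose \<open>u\<close> satisfies the \<open>RH\<^bsub>\<infinity>\<^esub>\<close> condition with constant \<open>c < p\<close>, and put \<open>q = 1 / (p - 1) = p' - 1\<close>. Fix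
  an interval \<open>I\<close> and let \<open>M\<close> be the essential supremum of \<open>u\<close> over \<open>I\<close>. The heart of the matter is
  that the average of \<open>u\<^sup>-\<^sup>q\<close> over \<open>I\<close> is at most \<open>K M\<^sup>-\<^sup>q\<close>, where \<open>K\<close> depends on \<open>c\<close> and \<open>q\<close> only.

  The definition of \<open>RH\<^bsub>\<infinity>\<^esub>\<close> compares \<open>u\<close> with its average on intervals. The sublevel sets
  \<open>E\<^sub>t = {x \<in> I. u x < t}\<close> with \<open>t < M\<close> inherit the comparison, and with the same constant:
  \<open>t |E\<^sub>t| \<le> c \<integral>\<^bsub>E\<^sub>t\<^esub> u\<close> (\<open>sublevel_set_reverse_bound\<close>). No constant is lost because an open subset of the
  line is a disjoint union of intervals, so that \<open>E\<^sub>t\<close> can be covered without overlaps. This is what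
  makes the range \<open>p > c\<close> come out sharp. Multiplying by \<open>t\<^bsup>-q-2\<^esup>\<close>, integrating over \<open>0 < t < M\<close> and
  exchanging the order of integration yields
  \<open>(\<integral>\<^bsub>I\<^esub> u\<^sup>-\<^sup>q - M\<^sup>-\<^sup>q |I|) / q \<le> c / (q + 1) \<integral>\<^bsub>I\<^esub> u\<^sup>-\<^sup>q\<close>, and the right-hand side can be absorbed exactly
  when \<open>c q < q + 1\<close>, that is, when \<open>c < p\<close> (\<open>sublevel_bound_imp_negative_moment\<close>).

  The factor \<open>v\<^bsup>1/r\<^esup>\<close> is harmless. If \<open>m\<close> is the average of \<open>v\<close> over \<open>I\<close>, then \<open>v\<close> is bounded below by a
  fixed multiple of \<open>m\<close> on \<open>I\<close>, and the average of \<open>v\<^bsup>1/r\<^esup>\<close> is at most \<open>2 m\<^bsup>1/r\<^esup>\<close>. Hence the average of \<open>w\<close>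
  is at most \<open>2 M m\<^bsup>1/r\<^esup>\<close>, whereas the dual average to the power \<open>p - 1\<close> is at most a constant times
  \<open>1 / (M m\<^bsup>1/r\<^esup>)\<close> (\<open>RHinf_A1_product_in_A_class\<close>).

  For sharpness take \<open>u = w = x\<^bsup>c-1\<^esup>\<close> and \<open>v = 1\<close> on the half-line. On \<open>(0, b)\<close> the supremum of \<open>u\<close> is
  exactly \<open>c\<close> times its average, and the dual weight \<open>x\<^bsup>-(c-1)/(p-1)\<^esup>\<close> is not integrable at \<open>0\<close> when
  \<open>p \<le> c\<close>.
\<close>

section \<open>Sublevel sets of functions with a reverse bound on intervals\<close>

lemma bounded_open_interval_eq:
  fixes J :: "real set"
  assumes "open J" "connected J" "bounded J" "J \<noteq> {}"
  obtains \<alpha> \<beta> where "\<alpha> < \<beta>" "J = {\<alpha><..<\<beta>}"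
proof
  have bdd: "bdd_below J" "bdd_above J"
    using assms(3) by (auto simp: bounded_imp_bdd_below bounded_imp_bdd_above)
  have between: "x \<in> J" if "y \<in> J" "z \<in> J" "y < x" "x < z" for x y z
    using assms(2) that by (meson connectedD_interval less_imp_le)
  show eq: "J = {Inf J<..<Sup J}"
  proof (intro set_eqI iffI)
    fix x assume x: "x \<in> J"
    then obtain e where e: "e > 0" "ball x e \<subseteq> J"
      using assms(1) openE by blast
    then have "x - e/2 \<in> J" "x + e/2 \<in> J"
      by (auto intro!: subsetD[OF e(2)] simp: dist_real_def)
    then have "Inf J \<le> x - e/2" "x + e/2 \<le> Sup J"
      using bdd by (auto intro: cInf_lower cSup_upper)
    then show "x \<in> {Inf J<..<Sup J}" using e by auto
  next
    fix x assume "x \<in> {Inf J<..<Sup J}"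
    then obtain y z where "y \<in> J" "y < x" "z \<in> J" "x < z"
      using assms(4) bdd by (auto simp: cInf_less_iff less_cSup_iff)
    then show "x \<in> J" using between by blast
  qed
  then show "Inf J < Sup J" using assms(4) by auto
qed

text \<open>
  Cover the sublevel set \<open>E\<close> by an open set \<open>G\<close> of almost the same measure and add up over the
  components of \<open>G\<close>. A component that lies inside \<open>E\<close> up to a null set escapes the hypothesis on
  intervals. To deal with it, let \<open>G\<close> contain the essential interior \<open>W\<close> of \<open>E\<close>, the largest open set
  on which \<open>u < lam\<close> almost everywhere: by maximality of the component, every enlargement of it then
  meets \<open>u \<ge> lam\<close> in positive measure, and the bound for the enlargements passes to the limit.
\<close>

lemma sublevel_set_reverse_bound:
  fixes u :: "real \<Rightarrow> real" and a b c M lam :: real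
  defines "A \<equiv> {a<..<b}"
  assumes ab: "a < b" and c: "0 \<le> c" and M: "0 \<le> M" and lam: "0 \<le> lam"
    and meas: "(\<lambda>x. ennreal (u x) * indicator A x) \<in> borel_measurable lebesgue"
    and bound: "AE x in lebesgue. x \<in> A \<longrightarrow> u x \<le> M"
    and interval_bound: "\<And>\<alpha> \<beta>. a \<le> \<alpha> \<Longrightarrow> \<alpha> < \<beta> \<Longrightarrow> \<beta> \<le> b
        \<Longrightarrow> \<not> (AE x in lebesgue. x \<in> {\<alpha><..<\<beta>} \<longrightarrow> u x < lam)
        \<Longrightarrow> ennreal (lam * (\<beta> - \<alpha>)) \<le> ennreal c * (\<integral>\<^sup>+x\<in>{\<alpha><..<\<beta>}. ennreal (u x) \<partial>lebesgue)"
    and not_all: "\<not> (AE x in lebesgue. x \<in> A \<longrightarrow> u x < lam)"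
    and E: "E = {x \<in> A. u x < lam}" "E \<in> sets lebesgue"
  shows "ennreal lam * emeasure lebesgue E \<le> ennreal c * (\<integral>\<^sup>+x\<in>E. ennreal (u x) \<partial>lebesgue)"
proof -
  define \<nu> where "\<nu> S = (\<integral>\<^sup>+x\<in>S. (ennreal (u x) * indicator A x) \<partial>lebesgue)" for S
  have \<nu>_eq: "\<nu> S = (\<integral>\<^sup>+x\<in>S. ennreal (u x) \<partial>lebesgue)" if "S \<subseteq> A" for S
    unfolding \<nu>_def using that by (intro nn_integral_cong) (auto simp: indicator_def)
  have \<nu>_density: "\<nu> S = emeasure (density lebesgue (\<lambda>x. ennreal (u x) * indicator A x)) S"
    if "S \<in> sets lebesgue" for S
    unfolding \<nu>_def using meas that by (subst emeasure_density) auto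
  have \<nu>_le: "\<nu> S \<le> ennreal M * emeasure lebesgue S" if "S \<in> sets lebesgue" for S
  proof -
    have "\<nu> S \<le> (\<integral>\<^sup>+x. ennreal M * indicator S x \<partial>lebesgue)"
      unfolding \<nu>_def using bound
      by (intro nn_integral_mono_AE) (auto elim!: eventually_mono simp: indicator_def intro: ennreal_leI)
    also have "\<dots> = ennreal M * emeasure lebesgue S"
      using that by (simp add: nn_integral_cmult_indicator)
    finally show ?thesis .
  qed
  have \<nu>_Un: "\<nu> (S \<union> T) \<le> \<nu> S + \<nu> T" if "S \<in> sets lebesgue" "T \<in> sets lebesgue" for S T
    using that by (simp add: \<nu>_density emeasure_subadditive)
  have \<nu>_mono: "\<nu> S \<le> \<nu> T" if "S \<subseteq> T" for S T
    unfolding \<nu>_def using that by (intro nn_integral_mono) (auto simp: indicator_def)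
  \<comment> \<open>\<open>W\<close> is the essential interior of \<open>E\<close>; it is contained in \<open>E\<close> up to a null set by Lindelof.\<close>
  define \<F> where "\<F> = {J. open J \<and> J \<subseteq> A \<and> (AE x in lebesgue. x \<in> J \<longrightarrow> u x < lam)}"
  define W where "W = \<Union>\<F>"
  have openW: "open W" and WA: "W \<subseteq> A" by (auto simp: W_def \<F>_def)
  have AE_W: "AE x in lebesgue. x \<in> W \<longrightarrow> u x < lam"
  proof -
    obtain \<F>' where F': "\<F>' \<subseteq> \<F>" "countable \<F>'" "\<Union>\<F>' = \<Union>\<F>"
      by (rule Lindelof[of \<F>]) (auto simp: \<F>_def)
    have "AE x in lebesgue. \<forall>J\<in>\<F>'. x \<in> J \<longrightarrow> u x < lam"
      using F' by (subst AE_ball_countable) (auto simp: \<F>_def)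
    then show ?thesis unfolding W_def F'(3)[symmetric] by (auto elim: eventually_mono)
  qed
  have component_bound: "ennreal lam * emeasure lebesgue J \<le> ennreal c * \<nu> J"
    if G: "open G" "W \<subseteq> G" "G \<subseteq> A" and J: "J \<in> components G" for G J
  proof -
    have "open J" "connected J" "J \<noteq> {}" "J \<subseteq> G"
      using G J by (auto simp: open_components in_components_connected in_components_nonempty in_components_subset)
    moreover have "bounded J"
      by (rule bounded_subset[of A]) (use \<open>J \<subseteq> G\<close> G in \<open>auto simp: A_def\<close>)
    ultimately obtain \<alpha> \<beta> where \<alpha>\<beta>: "\<alpha> < \<beta>" "J = {\<alpha><..<\<beta>}"
      using bounded_open_interval_eq by metis
    have JA: "{\<alpha><..<\<beta>} \<subseteq> {a<..<b}" using \<open>J \<subseteq> G\<close> G \<alpha>\<beta> by (auto simp: A_def)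
    then have ends: "a \<le> \<alpha>" "\<beta> \<le> b" using \<alpha>\<beta>(1) by (auto simp: greaterThanLessThan_subseteq_greaterThanLessThan)
    have step: "ennreal (lam * (\<beta> - \<alpha>)) \<le> ennreal c * \<nu> J + ennreal e" if "e > 0" for e
    proof -
      \<comment> \<open>Enlarging \<open>J\<close> by \<open>\<eta>\<close> on each side costs at most \<open>2 c M \<eta> \<le> e\<close>; the summand 1 only avoids a
          division by zero.\<close>
      define \<eta> where "\<eta> = e / (2 * c * M + 1)"
      have cM: "0 \<le> c * M" using c M by simp
      have \<eta>: "\<eta> > 0" unfolding \<eta>_def using that cM by (intro divide_pos_pos) auto
      have \<eta>e: "c * (M * (2 * \<eta>)) \<le> e" 
        unfolding \<eta>_def using that cM by (simp add: field_simps)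
      define \<alpha>' \<beta>' where "\<alpha>' = max a (\<alpha> - \<eta>)" and "\<beta>' = min b (\<beta> + \<eta>)"
      have I: "a \<le> \<alpha>'" "\<alpha>' \<le> \<alpha>" "\<beta> \<le> \<beta>'" "\<beta>' \<le> b" "\<alpha>' < \<beta>'" "\<alpha> - \<alpha>' \<le> \<eta>" "\<beta>' - \<beta> \<le> \<eta>"
        using ends \<eta> \<alpha>\<beta>(1) by (auto simp: \<alpha>'_def \<beta>'_def)
      \<comment> \<open>Otherwise the enlarged interval lies in \<open>W\<close>, hence in the component \<open>J\<close>. Then it is no
          enlargement at all, which happens only if \<open>J\<close> is the whole interval.\<close>
      have "\<not> (AE x in lebesgue. x \<in> {\<alpha>'<..<\<beta>'} \<longrightarrow> u x < lam)"
      proof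
        assume AE: "AE x in lebesgue. x \<in> {\<alpha>'<..<\<beta>'} \<longrightarrow> u x < lam"
        then have "{\<alpha>'<..<\<beta>'} \<in> \<F>" using I by (auto simp: \<F>_def A_def)
        then have "{\<alpha>'<..<\<beta>'} \<subseteq> G" using G by (auto simp: W_def)
        moreover have "J \<inter> {\<alpha>'<..<\<beta>'} \<noteq> {}"
          using \<alpha>\<beta> I dense[OF \<alpha>\<beta>(1)] by force
        ultimately have "{\<alpha>'<..<\<beta>'} \<subseteq> J"
          using J by (intro components_maximal[of J G]) auto
        then have "\<alpha> \<le> \<alpha>'" "\<beta>' \<le> \<beta>"
          using I(5) \<alpha>\<beta>(2) by (auto simp: greaterThanLessThan_subseteq_greaterThanLessThan)
        then have "\<alpha>' = a" "\<beta>' = b" using \<eta> I by (auto simp: \<alpha>'_def \<beta>'_def max_def min_def split: if_splits)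
        then show False using AE not_all by (simp add: A_def)
      qed
      then have "ennreal (lam * (\<beta>' - \<alpha>')) \<le> ennreal c * \<nu> {\<alpha>'<..<\<beta>'}"
        using I by (subst \<nu>_eq) (auto intro!: interval_bound simp: A_def)
      moreover have "ennreal (lam * (\<beta> - \<alpha>)) \<le> ennreal (lam * (\<beta>' - \<alpha>'))"
        using I lam by (intro ennreal_leI mult_left_mono) auto
      moreover have "\<nu> {\<alpha>'<..<\<beta>'} \<le> \<nu> J + ennreal (M * (2 * \<eta>))"
      proof -
        have "\<nu> {\<alpha>'<..<\<beta>'} \<le> \<nu> (J \<union> ({\<alpha>'..\<alpha>} \<union> {\<beta>..\<beta>'}))"
          by (intro \<nu>_mono) (auto simp: \<alpha>\<beta>(2))
        also have "\<dots> \<le> \<nu> J + \<nu> ({\<alpha>'..\<alpha>} \<union> {\<beta>..\<beta>'})"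
          by (intro \<nu>_Un) (auto simp: \<alpha>\<beta>(2))
        also have "\<nu> ({\<alpha>'..\<alpha>} \<union> {\<beta>..\<beta>'}) \<le> ennreal M * emeasure lebesgue ({\<alpha>'..\<alpha>} \<union> {\<beta>..\<beta>'})"
          by (intro \<nu>_le) auto
        also have "\<dots> \<le> ennreal M * (emeasure lebesgue {\<alpha>'..\<alpha>} + emeasure lebesgue {\<beta>..\<beta>'})"
          by (intro mult_left_mono emeasure_subadditive) auto
        also have "\<dots> = ennreal M * (ennreal (\<alpha> - \<alpha>') + ennreal (\<beta>' - \<beta>))"
          using I by simp
        also have "\<dots> = ennreal (M * ((\<alpha> - \<alpha>') + (\<beta>' - \<beta>)))"
          using I M by (simp add: ennreal_mult ennreal_plus)
        also have "\<dots> \<le> ennreal (M * (2 * \<eta>))"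
          using I M by (intro ennreal_leI mult_left_mono) auto
        finally show ?thesis by (simp add: add_left_mono)
      qed
      ultimately have "ennreal (lam * (\<beta> - \<alpha>)) \<le> ennreal c * (\<nu> J + ennreal (M * (2 * \<eta>)))"
        by (meson mult_left_mono order_trans zero_le)
      also have "\<dots> = ennreal c * \<nu> J + ennreal (c * (M * (2 * \<eta>)))"
        using c M \<eta> by (simp add: distrib_left ennreal_mult)
      also have "\<dots> \<le> ennreal c * \<nu> J + ennreal e"
        by (intro add_left_mono ennreal_leI \<eta>e)
      finally show ?thesis .
    qed
    have "ennreal lam * emeasure lebesgue J = ennreal (lam * (\<beta> - \<alpha>))"
      using \<alpha>\<beta> lam by (simp add: ennreal_mult)
    then show ?thesis using step by (auto intro: ennreal_le_epsilon)
  qed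
  have open_bound: "ennreal lam * emeasure lebesgue G \<le> ennreal c * \<nu> G"
    if G: "open G" "W \<subseteq> G" "G \<subseteq> A" for G
  proof -
    have opn: "open J" if "J \<in> components G" for J using open_components[OF G(1) that] .
    have cnt: "countable (components G)"
      by (rule countable_disjoint_open_subsets)
         (use opn pairwise_disjoint_components[of G] in \<open>auto simp: pairwise_def disjnt_def\<close>)
    have disj: "disjoint_family_on (\<lambda>J. J) (components G)"
      using pairwise_disjoint_components[of G] by (auto simp: pairwise_def disjoint_family_on_def)
    have sets: "J \<in> sets lebesgue" if "J \<in> components G" for J using opn[OF that] by auto
    have GU: "G = \<Union>((\<lambda>J. J) ` components G)" using Union_components[of G] by simp
    have "emeasure lebesgue G = (\<integral>\<^sup>+J. emeasure lebesgue J \<partial>count_space (components G))"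
      by (subst GU, rule emeasure_UN_countable) (use sets cnt disj in auto)
    then have "ennreal lam * emeasure lebesgue G
        = (\<integral>\<^sup>+J. ennreal lam * emeasure lebesgue J \<partial>count_space (components G))"
      by (simp add: nn_integral_cmult)
    also have "\<dots> \<le> (\<integral>\<^sup>+J. ennreal c * \<nu> J \<partial>count_space (components G))"
      using component_bound[OF G] by (intro nn_integral_mono) auto
    also have "\<dots> = ennreal c * (\<integral>\<^sup>+J. \<nu> J \<partial>count_space (components G))"
      by (simp add: nn_integral_cmult)
    also have "(\<integral>\<^sup>+J. \<nu> J \<partial>count_space (components G))
        = (\<integral>\<^sup>+J. emeasure (density lebesgue (\<lambda>x. ennreal (u x) * indicator A x)) J \<partial>count_space (components G))"
      by (intro nn_integral_cong \<nu>_density) (auto intro: sets)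
    also have "\<dots> = emeasure (density lebesgue (\<lambda>x. ennreal (u x) * indicator A x)) G"
      by (subst GU, rule emeasure_UN_countable[symmetric]) (use sets cnt disj in auto)
    also have "\<dots> = \<nu> G" using G(1) by (simp add: \<nu>_density)
    finally show ?thesis .
  qed
  have "ennreal lam * emeasure lebesgue E \<le> ennreal c * \<nu> E + ennreal e" if "e > 0" for e
  proof -
    define \<eta> where "\<eta> = e / (c * M + 1)"
    have cM: "0 \<le> c * M" using c M by simp
    have \<eta>: "\<eta> > 0" unfolding \<eta>_def using that cM by (intro divide_pos_pos) auto
    have \<eta>e: "c * (M * \<eta>) \<le> e" 
      unfolding \<eta>_def using that cM by (simp add: field_simps)
    obtain T where T: "open T" "E \<subseteq> T" "(T - E) \<in> lmeasurable" "emeasure lebesgue (T - E) < ennreal \<eta>"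
      using sets_lebesgue_outer_open[OF E(2) \<eta>] .
    define G where "G = (T \<inter> A) \<union> W"
    have G: "open G" "W \<subseteq> G" "G \<subseteq> A" "E \<subseteq> G"
      using T(1,2) openW WA E(1) unfolding G_def A_def
      by (intro open_Un open_Int open_greaterThanLessThan, auto)
    have WE: "emeasure lebesgue (W - E) = 0"
    proof -
      have "AE x in lebesgue. x \<notin> W - E"
        using AE_W by (rule eventually_mono) (use WA E(1) in auto)
      then show ?thesis using openW E(2) 
        by (subst AE_iff_measurable[symmetric, where P="\<lambda>x. x \<notin> W - E"]) auto
    qed
    have [measurable]: "G \<in> sets lebesgue" "E \<in> sets lebesgue" "W \<in> sets lebesgue" "T \<in> sets lebesgue"
      using G(1) E(2) openW T(1) by auto
    have "emeasure lebesgue (G - E) \<le> emeasure lebesgue ((T - E) \<union> (W - E))"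
      by (intro emeasure_mono) (auto simp: G_def)
    also have "\<dots> \<le> emeasure lebesgue (T - E) + emeasure lebesgue (W - E)"
      by (intro emeasure_subadditive) auto
    also have "\<dots> \<le> ennreal \<eta>" using T(4) WE by simp
    finally have GE: "emeasure lebesgue (G - E) \<le> ennreal \<eta>" .
    have "ennreal lam * emeasure lebesgue E \<le> ennreal lam * emeasure lebesgue G"
      using G(4) by (intro mult_left_mono emeasure_mono) auto
    also have "\<dots> \<le> ennreal c * \<nu> G" by (rule open_bound[OF G(1-3)])
    also have "\<nu> G = \<nu> (E \<union> (G - E))" using G(4) by (simp add: Un_absorb1)
    also have "\<dots> \<le> \<nu> E + \<nu> (G - E)" by (intro \<nu>_Un) auto
    also have "\<nu> (G - E) \<le> ennreal M * ennreal \<eta>"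
      by (rule order_trans[OF \<nu>_le]) (use GE in \<open>auto intro: mult_left_mono\<close>)
    also have "ennreal c * (\<nu> E + ennreal M * ennreal \<eta>) = ennreal c * \<nu> E + ennreal (c * (M * \<eta>))"
      using c M \<eta> by (simp add: distrib_left ennreal_mult)
    also have "\<dots> \<le> ennreal c * \<nu> E + ennreal e"
      by (intro add_left_mono ennreal_leI \<eta>e)
    finally show ?thesis by (simp add: add_left_mono mult_left_mono)
  qed
  then have "ennreal lam * emeasure lebesgue E \<le> ennreal c * \<nu> E"
    by (auto intro: ennreal_le_epsilon)
  also have "\<nu> E = (\<integral>\<^sup>+x\<in>E. ennreal (u x) \<partial>lebesgue)" by (rule \<nu>_eq) (auto simp: E)
  finally show ?thesis .
qed

section \<open>Negative moments from sublevel bounds\<close>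

lemma nn_integral_powr_Ioo:
  fixes s M k :: real
  assumes "0 < s" "s \<le> M" "0 < k"
  shows "(\<integral>\<^sup>+t. ennreal (t powr (- k - 1)) * indicator {s<..<M} t \<partial>lborel)
    = ennreal ((s powr (- k) - M powr (- k)) / k)"
proof -
  have "(\<integral>\<^sup>+t. ennreal (t powr (- k - 1)) * indicator {s<..<M} t \<partial>lborel)
      = (\<integral>\<^sup>+t. ennreal (t powr (- k - 1)) * indicator {s..M} t \<partial>lborel)"
    using AE_lborel_singleton[of s] AE_lborel_singleton[of M]
    by (intro nn_integral_cong_AE) (auto simp: indicator_def)
  also have "\<dots> = ennreal (- (M powr (- k)) / k - - (s powr (- k)) / k)"
  proof (rule nn_integral_FTC_Icc)
    fix t assume "t \<in> {s..M}"
    then have "t > 0" using assms by auto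
    then show "((\<lambda>t. - (t powr (- k)) / k) has_real_derivative t powr (- k - 1)) (at t)"
      using assms by (auto intro!: derivative_eq_intros)
  qed (use assms in auto)
  finally show ?thesis by (simp add: diff_divide_distrib)
qed

text \<open>
  Multiply the bound at level \<open>t\<close> by \<open>t powr (- q - 2)\<close> and integrate over \<open>t\<close>. By Tonelli, the left-hand
  side becomes \<open>(u powr (- q) - M powr (- q)) / q\<close>, integrated, and the right-hand side is at most
  \<open>c / (q + 1)\<close> times the integral of \<open>u powr (- q)\<close>; since \<open>c / (q + 1) < 1 / q\<close>, it can be absorbed. The
  absorption requires a finite integral, so it is carried out for \<open>max u \<epsilon>\<close> in place of \<open>u\<close>,
  uniformly in \<open>\<epsilon>\<close>.
\<close>

lemma sublevel_bound_imp_negative_moment: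
  fixes u :: "'a \<Rightarrow> real" and M q c :: real
  assumes "finite_measure N" and meas[measurable]: "u \<in> borel_measurable N"
    and pos: "\<And>x. x \<in> space N \<Longrightarrow> 0 < u x" and bound: "AE x in N. u x \<le> M"
    and M: "0 < M" and q: "0 < q" and c: "0 \<le> c" "c * q < q + 1"
    and sublevel: "\<And>t. 0 < t \<Longrightarrow> t < M \<Longrightarrow>
      ennreal t * emeasure N {x \<in> space N. u x < t}
        \<le> ennreal c * (\<integral>\<^sup>+x\<in>{x \<in> space N. u x < t}. ennreal (u x) \<partial>N)"
  shows "(\<integral>\<^sup>+x. ennreal (u x powr (- q)) \<partial>N)
    \<le> ennreal ((q + 1) / (q + 1 - c * q) * M powr (- q)) * emeasure N (space N)"
proof -
  interpret N: finite_measure N by fact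
  interpret P: pair_sigma_finite N lborel ..
  define V where "V = measure N (space N)"
  have V: "emeasure N (space N) = ennreal V" "0 \<le> V"
    by (simp_all add: V_def N.emeasure_eq_measure)
  define K where "K = (q + 1) / (q + 1 - c * q)"
  have truncated: "(\<integral>\<^sup>+x. ennreal (max (u x) \<epsilon> powr (- q)) \<partial>N) \<le> ennreal (K * M powr (- q) * V)"
    if \<epsilon>: "0 < \<epsilon>" "\<epsilon> < M" for \<epsilon>
  proof -
    define \<phi> where "\<phi> x = max (u x) \<epsilon>" for x
    have [measurable]: "\<phi> \<in> borel_measurable N" unfolding \<phi>_def by measurable
    have layer: "(\<integral>\<^sup>+t. ennreal (t powr (- k - 1)) * indicator {\<epsilon><..<M} t * indicator {u x<..} t \<partial>lborel)
      = ennreal ((\<phi> x powr (- k) - M powr (- k)) / k)" if "u x \<le> M" "0 < k" for x k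
    proof -
      have "(\<integral>\<^sup>+t. ennreal (t powr (- k - 1)) * indicator {\<epsilon><..<M} t * indicator {u x<..} t \<partial>lborel)
        = (\<integral>\<^sup>+t. ennreal (t powr (- k - 1)) * indicator {\<phi> x<..<M} t \<partial>lborel)"
        by (intro nn_integral_cong) (auto simp: indicator_def \<phi>_def)
      also have "\<dots> = ennreal ((\<phi> x powr (- k) - M powr (- k)) / k)"
        using that \<epsilon> by (intro nn_integral_powr_Ioo) (auto simp: \<phi>_def)
      finally show ?thesis .
    qed
    have "(\<integral>\<^sup>+x. ennreal ((\<phi> x powr (- q) - M powr (- q)) / q) \<partial>N)
      = (\<integral>\<^sup>+x. (\<integral>\<^sup>+t. ennreal (t powr (- q - 1)) * indicator {\<epsilon><..<M} t * indicator {u x<..} t \<partial>lborel) \<partial>N)"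
      using bound by (intro nn_integral_cong_AE) (auto elim!: eventually_mono simp: layer q)
    also have "\<dots> = (\<integral>\<^sup>+t. (\<integral>\<^sup>+x. ennreal (t powr (- q - 1)) * indicator {\<epsilon><..<M} t * indicator {u x<..} t \<partial>N) \<partial>lborel)"
      by (intro P.Fubini'[symmetric]) (simp add: indicator_def)
    also have "\<dots> \<le> (\<integral>\<^sup>+t. (\<integral>\<^sup>+x. ennreal c * ennreal (u x) * (ennreal (t powr (- (q + 1) - 1)) * indicator {\<epsilon><..<M} t * indicator {u x<..} t) \<partial>N) \<partial>lborel)"
    proof (rule nn_integral_mono)
      fix t :: real
      show "(\<integral>\<^sup>+x. ennreal (t powr (- q - 1)) * indicator {\<epsilon><..<M} t * indicator {u x<..} t \<partial>N)
        \<le> (\<integral>\<^sup>+x. ennreal c * ennreal (u x) * (ennreal (t powr (- (q + 1) - 1)) * indicator {\<epsilon><..<M} t * indicator {u x<..} t) \<partial>N)"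
      proof (cases "t \<in> {\<epsilon><..<M}")
        case True
        then have t: "0 < t" "t < M" using \<epsilon> by auto
        have split: "t powr (- q - 1) = t powr (- (q + 1) - 1) * t"
          using t by (simp add: powr_diff powr_minus field_simps powr_add power2_eq_square)
        have "(\<integral>\<^sup>+x. ennreal (t powr (- q - 1)) * indicator {\<epsilon><..<M} t * indicator {u x<..} t \<partial>N)
          = (\<integral>\<^sup>+x. ennreal (t powr (- q - 1)) * indicator {x \<in> space N. u x < t} x \<partial>N)"
          using True by (intro nn_integral_cong) (auto simp: indicator_def)
        also have "\<dots> = ennreal (t powr (- (q + 1) - 1)) * (ennreal t * emeasure N {x \<in> space N. u x < t})"
          using t by (subst nn_integral_cmult_indicator) (auto simp: split ennreal_mult mult.assoc)
        also have "\<dots> \<le> ennreal (t powr (- (q + 1) - 1)) *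
            (ennreal c * (\<integral>\<^sup>+x\<in>{x \<in> space N. u x < t}. ennreal (u x) \<partial>N))"
          by (intro mult_left_mono sublevel t) auto
        also have "\<dots> = (\<integral>\<^sup>+x. ennreal (t powr (- (q + 1) - 1)) * (ennreal c *
            (ennreal (u x) * indicator {x \<in> space N. u x < t} x)) \<partial>N)"
          by (simp add: nn_integral_cmult)
        also have "\<dots> = (\<integral>\<^sup>+x. ennreal c * ennreal (u x) * (ennreal (t powr (- (q + 1) - 1)) * indicator {\<epsilon><..<M} t * indicator {u x<..} t) \<partial>N)"
          using True by (intro nn_integral_cong) (auto simp: indicator_def mult_ac)
        finally show ?thesis .
      qed simp
    qed
    also have "\<dots> = (\<integral>\<^sup>+x. (\<integral>\<^sup>+t. ennreal c * ennreal (u x) * (ennreal (t powr (- (q + 1) - 1)) * indicator {\<epsilon><..<M} t * indicator {u x<..} t) \<partial>lborel) \<partial>N)"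
      by (intro P.Fubini') (simp add: indicator_def)
    also have "\<dots> = (\<integral>\<^sup>+x. ennreal c * ennreal (u x) * (\<integral>\<^sup>+t. ennreal (t powr (- (q + 1) - 1)) * indicator {\<epsilon><..<M} t * indicator {u x<..} t \<partial>lborel) \<partial>N)"
      by (intro nn_integral_cong nn_integral_cmult) simp
    also have "\<dots> \<le> (\<integral>\<^sup>+x. ennreal (c / (q + 1)) * ennreal (\<phi> x powr (- q)) \<partial>N)"
    proof (rule nn_integral_mono_AE)
      have pointwise: "ennreal c * ennreal (u x) * (\<integral>\<^sup>+t. ennreal (t powr (- (q + 1) - 1)) * indicator {\<epsilon><..<M} t * indicator {u x<..} t \<partial>lborel)
          \<le> ennreal (c / (q + 1)) * ennreal (\<phi> x powr (- q))" if x: "x \<in> space N" "u x \<le> M" for x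
      proof -
        have \<phi>: "u x \<le> \<phi> x" "0 < \<phi> x" "0 < u x" "\<phi> x \<le> M" using \<epsilon> x pos by (auto simp: \<phi>_def)
        have "u x * (\<phi> x powr (- (q + 1)) - M powr (- (q + 1))) \<le> \<phi> x * \<phi> x powr (- (q + 1))"
          using \<phi> q by (intro mult_mono) (auto intro: powr_mono2')
        also have "\<phi> x * \<phi> x powr (- (q + 1)) = \<phi> x powr (- q)"
          using \<phi> powr_add[of "\<phi> x" 1 "- (q + 1)"] by simp
        finally have "c / (q + 1) * (u x * (\<phi> x powr (- (q + 1)) - M powr (- (q + 1)))) \<le> c / (q + 1) * \<phi> x powr (- q)"
          using c q by (intro mult_left_mono) auto
        moreover have "0 \<le> (\<phi> x powr (- (q + 1)) - M powr (- (q + 1))) / (q + 1)"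
          using \<phi> q powr_mono2'[of "- (q + 1)" "\<phi> x" M] by (intro divide_nonneg_nonneg) auto
        ultimately show ?thesis
          using \<phi> c q x by (subst layer) (auto simp: ennreal_mult[symmetric] intro!: ennreal_leI)
      qed
      show "AE x in N. ennreal c * ennreal (u x) * (\<integral>\<^sup>+t. ennreal (t powr (- (q + 1) - 1)) * indicator {\<epsilon><..<M} t * indicator {u x<..} t \<partial>lborel)
          \<le> ennreal (c / (q + 1)) * ennreal (\<phi> x powr (- q))"
        using AE_space bound by eventually_elim (rule pointwise)
    qed
    also have "\<dots> = ennreal (c / (q + 1)) * (\<integral>\<^sup>+x. ennreal (\<phi> x powr (- q)) \<partial>N)"
      by (simp add: nn_integral_cmult)
    finally have key: "(\<integral>\<^sup>+x. ennreal ((\<phi> x powr (- q) - M powr (- q)) / q) \<partial>N)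
      \<le> ennreal (c / (q + 1)) * (\<integral>\<^sup>+x. ennreal (\<phi> x powr (- q)) \<partial>N)" .
    have "(\<integral>\<^sup>+x. ennreal (\<phi> x powr (- q)) \<partial>N) \<le> (\<integral>\<^sup>+x. ennreal (\<epsilon> powr (- q)) \<partial>N)"
      using \<epsilon> q by (intro nn_integral_mono ennreal_leI powr_mono2') (auto simp: \<phi>_def)
    also have "\<dots> < \<infinity>" using V by (simp add: ennreal_mult_less_top)
    finally obtain X where X: "(\<integral>\<^sup>+x. ennreal (\<phi> x powr (- q)) \<partial>N) = ennreal X" "0 \<le> X"
      by (cases "(\<integral>\<^sup>+x. ennreal (\<phi> x powr (- q)) \<partial>N)") auto
    have "ennreal (1 / q * X) = (\<integral>\<^sup>+x. ennreal (1 / q) * ennreal (\<phi> x powr (- q)) \<partial>N)"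
      using q X by (subst nn_integral_cmult) (auto simp: ennreal_mult[symmetric])
    also have "\<dots> \<le> (\<integral>\<^sup>+x. ennreal ((\<phi> x powr (- q) - M powr (- q)) / q) + ennreal (M powr (- q) / q) \<partial>N)"
    proof (rule nn_integral_mono_AE)
      show "AE x in N. ennreal (1 / q) * ennreal (\<phi> x powr (- q))
        \<le> ennreal ((\<phi> x powr (- q) - M powr (- q)) / q) + ennreal (M powr (- q) / q)"
        using bound
      proof eventually_elim
        case (elim x)
        then have "M powr (- q) \<le> \<phi> x powr (- q)" using \<epsilon> q by (intro powr_mono2') (auto simp: \<phi>_def)
        then show ?case using q
          by (subst ennreal_plus[symmetric]) (auto simp: ennreal_mult[symmetric] diff_divide_distrib divide_right_mono)
      qed
    qed
    also have "\<dots> = (\<integral>\<^sup>+x. ennreal ((\<phi> x powr (- q) - M powr (- q)) / q) \<partial>N) + ennreal (M powr (- q) / q) * V"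
      by (simp add: nn_integral_add V)
    also have "\<dots> \<le> ennreal (c / (q + 1)) * ennreal X + ennreal (M powr (- q) / q) * V"
      using key X by (intro add_right_mono) simp
    also have "\<dots> = ennreal (c / (q + 1) * X + M powr (- q) / q * V)"
      using c q X V by (subst ennreal_plus) (auto simp: ennreal_mult[symmetric])
    finally have "1 / q * X \<le> c / (q + 1) * X + M powr (- q) / q * V"
      using c q X V by (subst (asm) ennreal_le_iff) auto
    then have "X * (q + 1 - c * q) \<le> (q + 1) * (M powr (- q) * V)"
    proof -
      assume "1 / q * X \<le> c / (q + 1) * X + M powr (- q) / q * V"
      then have "1 / q * X * (q * (q + 1)) \<le> (c / (q + 1) * X + M powr (- q) / q * V) * (q * (q + 1))"
        using q by (intro mult_right_mono) auto
      moreover have "1 / q * X * (q * (q + 1)) = X * (q + 1)" using q by simp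
      moreover have "c / (q + 1) * X * (q * (q + 1)) = X * (c * q)" using q by (simp add: divide_simps)
      moreover have "M powr (- q) / q * V * (q * (q + 1)) = (q + 1) * (M powr (- q) * V)" using q by simp
      ultimately show ?thesis by (simp add: distrib_right right_diff_distrib)
    qed
    then have "X \<le> K * M powr (- q) * V"
      unfolding K_def using c q by (simp add: field_simps)
    then show ?thesis using X by (auto simp: \<phi>_def intro: ennreal_leI)
  qed
  \<comment> \<open>The denominator \<open>n + 2\<close> keeps every \<open>\<epsilon> n\<close> below \<open>M\<close>. For fixed \<open>x\<close> the truncation is
    eventually inactive, so Fatou's lemma removes it.\<close>
  define \<epsilon> where "\<epsilon> n = M / (real n + 2)" for n :: nat
  have \<epsilon>: "0 < \<epsilon> n" "\<epsilon> n < M" for n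
    using M by (auto simp: \<epsilon>_def divide_less_eq)
  have \<epsilon>0: "\<epsilon> \<longlonglongrightarrow> 0" unfolding \<epsilon>_def by real_asymp
  have "(\<integral>\<^sup>+x. ennreal (u x powr (- q)) \<partial>N)
      = (\<integral>\<^sup>+x. liminf (\<lambda>n. ennreal (max (u x) (\<epsilon> n) powr (- q))) \<partial>N)"
  proof (rule nn_integral_cong)
    fix x assume "x \<in> space N"
    then have "\<forall>\<^sub>F n in sequentially. \<epsilon> n < u x"
      using \<epsilon>0 pos order_tendstoD(2) by blast
    then have "\<forall>\<^sub>F n in sequentially. ennreal (max (u x) (\<epsilon> n) powr (- q)) = ennreal (u x powr (- q))"
      by eventually_elim (simp add: max_def)
    then have "(\<lambda>n. ennreal (max (u x) (\<epsilon> n) powr (- q))) \<longlonglongrightarrow> ennreal (u x powr (- q))"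
      by (rule tendsto_eventually)
    then show "ennreal (u x powr (- q)) = liminf (\<lambda>n. ennreal (max (u x) (\<epsilon> n) powr (- q)))"
      by (rule lim_imp_Liminf[OF sequentially_bot, symmetric])
  qed
  also have "\<dots> \<le> liminf (\<lambda>n. \<integral>\<^sup>+x. ennreal (max (u x) (\<epsilon> n) powr (- q)) \<partial>N)"
    by (rule nn_integral_liminf) simp
  also have "\<dots> \<le> ennreal (K * M powr (- q) * V)"
    using truncated[OF \<epsilon>] by (intro order_trans[OF Liminf_le_Limsup Limsup_bounded]) auto
  also have "\<dots> = ennreal (K * M powr (- q)) * emeasure N (space N)"
    using V by (simp add: ennreal_mult'')
  finally show ?thesis by (simp add: K_def)
qed

section \<open>Intervals, averages and the weight classes\<close>

text \<open>
  All conditions are insensitive to null sets, and an interval differs from its interior in at most two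
  points. This reduces them to open intervals.
\<close>

lemma bounded_interval_inE:
  assumes "bounded_interval_in X I"
  obtains a b where "a < b" "{a<..<b} \<subseteq> I" "I \<subseteq> {a..b}" "I \<in> sets lebesgue" "I \<subseteq> X"
proof
  have I: "is_interval I" "bounded I" "I \<subseteq> X" "0 < emeasure lebesgue I"
    using assms by (auto simp: bounded_interval_in_def)
  have bdd: "bdd_below I" "bdd_above I"
    using I(2) by (auto simp: bounded_imp_bdd_below bounded_imp_bdd_above)
  have ne: "I \<noteq> {}" using I(4) by auto
  show sup: "I \<subseteq> {Inf I..Sup I}"
    using bdd by (auto intro: cInf_lower cSup_upper)
  show inn: "{Inf I<..<Sup I} \<subseteq> I"
  proof
    fix x assume "x \<in> {Inf I<..<Sup I}"
    then obtain y z where "y \<in> I" "y < x" "z \<in> I" "x < z"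
      using ne bdd by (auto simp: cInf_less_iff less_cSup_iff)
    then show "x \<in> I" using I(1) unfolding is_interval_1 by (meson less_imp_le)
  qed
  have "I = {Inf I<..<Sup I} \<union> (I \<inter> {Inf I, Sup I})" using sup inn by force
  moreover have "finite (I \<inter> {Inf I, Sup I})" by simp
  ultimately show "I \<in> sets lebesgue" 
    by (metis borel_open finite_imp_closed lborelD borel_closed open_greaterThanLessThan sets.Un sets_completionI_sets sets_lborel)
  show "Inf I < Sup I"
  proof (rule ccontr)
    assume "\<not> Inf I < Sup I"
    then have "I \<subseteq> {Inf I}" using sup by auto
    then have "emeasure lebesgue I \<le> emeasure lebesgue {Inf I}" by (intro emeasure_mono) auto
    then show False using I(4) by simp
  qed
  show "I \<subseteq> X" by fact
qed

lemma bounded_interval_in_Ioo: "a < b \<Longrightarrow> {a<..<b} \<subseteq> X \<Longrightarrow> bounded_interval_in X {a<..<b}"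
  by (simp add: bounded_interval_in_def is_interval_def) 

lemma average_interior:
  assumes "{a<..<b} \<subseteq> I" "I \<subseteq> {a..b}" "I \<in> sets lebesgue"
  shows "average I f = average {a<..<b} f"
proof -
  have AE: "AE x in lebesgue. x \<in> I \<longleftrightarrow> x \<in> {a<..<b}"
  proof (rule AE_I')
    show "{a, b} \<in> null_sets lebesgue" by (simp add: negligible_iff_null_sets[symmetric])
  qed (use assms in force)
  have "emeasure lebesgue I = emeasure lebesgue {a<..<b}"
    using AE assms(3) by (intro emeasure_eq_AE) auto
  moreover have "(\<integral>\<^sup>+x\<in>I. ennreal (f x) \<partial>lebesgue) = (\<integral>\<^sup>+x\<in>{a<..<b}. ennreal (f x) \<partial>lebesgue)"
    using AE by (intro nn_integral_cong_AE) (auto elim!: eventually_mono simp: indicator_def)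
  ultimately show ?thesis unfolding average_def by simp
qed

lemma average_Ioo:
  "a < b \<Longrightarrow> average {a<..<b} f = (\<integral>\<^sup>+x\<in>{a<..<b}. ennreal (f x) \<partial>lebesgue) / ennreal (b - a)"
  by (simp add: average_def)

lemma set_nn_integral_eq_average:
  "a < b \<Longrightarrow> (\<integral>\<^sup>+x\<in>{a<..<b}. ennreal (f x) \<partial>lebesgue) = average {a<..<b} f * ennreal (b - a)"
  by (simp add: average_Ioo ennreal_divide_times ennreal_divide_self)

lemma average_le:
  assumes "a < b" "0 \<le> k" "(\<integral>\<^sup>+x\<in>{a<..<b}. ennreal (f x) \<partial>lebesgue) \<le> ennreal (k * (b - a))"
  shows "average {a<..<b} f \<le> ennreal k"
proof -
  have "average {a<..<b} f \<le> ennreal (k * (b - a)) / ennreal (b - a)"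
    unfolding average_Ioo[OF assms(1)] by (rule divide_right_mono_ennreal) fact
  also have "\<dots> = ennreal k" using assms by (simp add: divide_ennreal)
  finally show ?thesis .
qed

lemma average_mono:
  assumes "AE x in lebesgue. x \<in> I \<longrightarrow> f x \<le> g x"
  shows "average I f \<le> average I g"
  unfolding average_def using assms
  by (intro divide_right_mono_ennreal nn_integral_mono_AE)
     (auto elim!: eventually_mono simp: indicator_def intro: ennreal_leI)

lemma ennreal_powr_le:
  assumes "x \<le> ennreal y" "0 \<le> y" "0 \<le> a"
  shows "ennreal_powr x a \<le> ennreal (y powr a)"
proof -
  obtain z where z: "x = ennreal z" "0 \<le> z" using assms(1) by (cases x) (auto simp: top_unique)
  then have "z \<le> y" using assms by simp
  then have "z powr a \<le> y powr a" using z assms by (intro powr_mono2) auto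
  then show ?thesis using z by (simp add: ennreal_powr_def)
qed

lemma weight_on_measurable:
  assumes "weight_on X w" "a < b" "{a<..<b} \<subseteq> X"
  shows "w \<in> borel_measurable (lebesgue_on {a<..<b})"
    and "(\<lambda>x. ennreal (w x) * indicator {a<..<b} x) \<in> borel_measurable lebesgue"
proof -
  have int: "set_integrable lebesgue {a<..<b} w"
    using assms bounded_interval_in_Ioo by (auto simp: weight_on_def)
  then have m: "(\<lambda>x. indicator {a<..<b} x *\<^sub>R w x) \<in> borel_measurable lebesgue"
    unfolding set_integrable_def by auto
  then show "w \<in> borel_measurable (lebesgue_on {a<..<b})"
    by (subst borel_measurable_restrict_space_iff) auto
  have "(\<lambda>x. ennreal (indicator {a<..<b} x *\<^sub>R w x)) \<in> borel_measurable lebesgue"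
    using m by measurable
  also have "(\<lambda>x. ennreal (indicator {a<..<b} x *\<^sub>R w x)) = (\<lambda>x. ennreal (w x) * indicator {a<..<b} x)"
    by (auto simp: indicator_def)
  finally show "(\<lambda>x. ennreal (w x) * indicator {a<..<b} x) \<in> borel_measurable lebesgue" .
qed

lemma weight_on_average:
  assumes "weight_on X w" "a < b" "{a<..<b} \<subseteq> X"
  obtains m where "0 < m" "average {a<..<b} w = ennreal m"
    "(\<integral>\<^sup>+x\<in>{a<..<b}. ennreal (w x) \<partial>lebesgue) = ennreal (m * (b - a))"
proof -
  let ?J = "\<integral>\<^sup>+x\<in>{a<..<b}. ennreal (w x) \<partial>lebesgue"
  have pos: "\<And>x. x \<in> {a<..<b} \<Longrightarrow> 0 < w x" using assms by (auto simp: weight_on_def)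
  have int: "set_integrable lebesgue {a<..<b} w"
    using assms bounded_interval_in_Ioo by (auto simp: weight_on_def)
  have "?J = (\<integral>\<^sup>+x. ennreal (norm (indicator {a<..<b} x *\<^sub>R w x)) \<partial>lebesgue)"
    using pos by (intro nn_integral_cong) (auto simp: indicator_def abs_of_pos)
  also have "\<dots> < \<infinity>"
    using int unfolding set_integrable_def by (auto simp: integrable_iff_bounded)
  finally have fin: "?J < \<infinity>" .
  have "?J \<noteq> 0"
  proof
    assume "?J = 0"
    then have "AE x in lebesgue. ennreal (w x) * indicator {a<..<b} x = 0"
      using weight_on_measurable(2)[OF assms] by (simp add: nn_integral_0_iff_AE)
    then have "AE x in lebesgue. x \<notin> {a<..<b}"
      by (rule eventually_mono) (use pos in \<open>force simp: indicator_def split: if_splits\<close>)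
    then have "emeasure lebesgue {a<..<b} = 0"
      by (subst AE_iff_measurable[symmetric, where P="\<lambda>x. x \<notin> {a<..<b}"]) auto
    then show False using assms by simp
  qed
  then obtain j where j: "?J = ennreal j" "0 < j" using fin by (cases ?J) (auto simp: less_le)
  show ?thesis
  proof (rule that[of "j / (b - a)"])
    show "average {a<..<b} w = ennreal (j / (b - a))"
      using j assms by (simp add: average_Ioo divide_ennreal)
  qed (use j assms in auto)
qed

lemma A_classI:
  assumes "weight_on X w"
    and "\<And>a b. a < b \<Longrightarrow> {a<..<b} \<subseteq> X \<Longrightarrow>
        average {a<..<b} w * ennreal_powr (average {a<..<b} (\<lambda>x. w x powr (1 - p / (p - 1)))) (p - 1)
          \<le> ennreal C"
  shows "w \<in> A_class X p"
proof -
  have "average I w * ennreal_powr (average I (\<lambda>x. w x powr (1 - p / (p - 1)))) (p - 1) \<le> ennreal C"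
    if I: "bounded_interval_in X I" for I
  proof -
    obtain a b where ab: "a < b" "{a<..<b} \<subseteq> I" "I \<subseteq> {a..b}" "I \<in> sets lebesgue" "I \<subseteq> X"
      using bounded_interval_inE[OF I] .
    then show ?thesis using assms(2)[of a b] by (simp add: average_interior[OF ab(2-4)])
  qed
  then show ?thesis using assms(1) by (auto simp: A_class_def)
qed

text \<open>
  The constant is taken strictly larger than the one from the definition of \<open>A\<^sub>1\<close>, so that \<open>m / c\<close> lies
  strictly below the essential infimum and is therefore an almost everywhere lower bound.
\<close>

lemma A1_lower_bound:
  assumes "v \<in> A1_class X"
  obtains c where "0 < c" "\<And>a b m. a < b \<Longrightarrow> {a<..<b} \<subseteq> X \<Longrightarrow> average {a<..<b} v = ennreal m
    \<Longrightarrow> 0 < m \<Longrightarrow> AE x in lebesgue. x \<in> {a<..<b} \<longrightarrow> m / c \<le> v x"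
proof -
  obtain c0 where c0: "\<And>I. bounded_interval_in X I \<Longrightarrow> average I v \<le> ennreal c0 * essinf_on I v"
    using assms by (auto simp: A1_class_def)
  define c where "c = max c0 0 + 1"
  show ?thesis
  proof (rule that[of c])
    show c: "0 < c" by (simp add: c_def)
    fix a b m :: real
    assume ab: "a < b" "{a<..<b} \<subseteq> X" and m: "average {a<..<b} v = ennreal m" "0 < m"
    let ?e = "essinf_on {a<..<b} v"
    have le: "ennreal m \<le> ennreal c0 * ?e" 
      using c0[OF bounded_interval_in_Ioo[OF ab]] m by simp
    have "ennreal (m / c) < ?e"
    proof (rule ccontr)
      assume "\<not> ennreal (m / c) < ?e"
      then have "ennreal c0 * ?e \<le> ennreal (max c0 0) * ennreal (m / c)"
        by (intro mult_mono) (auto intro: ennreal_leI)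
      then have "ennreal m \<le> ennreal (max c0 0 * (m / c))"
        using le m c by (simp only: ennreal_mult max.cobounded2 divide_nonneg_pos less_imp_le)
      then have "m \<le> max c0 0 * (m / c)"
        using m c by (subst (asm) ennreal_le_iff) (auto intro!: divide_nonneg_nonneg mult_nonneg_nonneg)
      then have "m * c \<le> max c0 0 * m" using c by (simp add: field_simps)
      then show False using m by (simp add: c_def distrib_left)
    qed
    then have "ennreal (m / c) < Liminf (ae_filter (lebesgue_on {a<..<b})) (\<lambda>x. ennreal (v x))"
      by (auto simp: essinf_on_def essinf_def split: if_splits)
    from less_LiminfD[OF this] have "AE x in lebesgue. x \<in> {a<..<b} \<longrightarrow> ennreal (m / c) < ennreal (v x)"
      by (subst (asm) AE_restrict_space_iff) auto
    then show "AE x in lebesgue. x \<in> {a<..<b} \<longrightarrow> m / c \<le> v x"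
      by (rule eventually_mono) (use m c in \<open>auto simp: ennreal_less_iff\<close>)
  qed
qed

text \<open>
  The \<open>RH\<^bsub>\<infinity>\<^esub>\<close> condition in the form to which the covering argument applies: an interval on which \<open>u\<close> is
  not essentially below \<open>t\<close> carries its share of the integral.
\<close>

lemma RHinf_not_below:
  assumes u: "weight_on X u" and c: "c \<in> RHinf_constants X u" and ab: "a < b" "{a<..<b} \<subseteq> X"
    and not_below: "\<not> (AE x in lebesgue. x \<in> {a<..<b} \<longrightarrow> u x < t)"
  shows "ennreal (t * (b - a)) \<le> ennreal c * (\<integral>\<^sup>+x\<in>{a<..<b}. ennreal (u x) \<partial>lebesgue)"
proof -
  let ?s = "esssup_on {a<..<b} u"
  have "ennreal t \<le> ?s"
  proof (rule ccontr)
    assume "\<not> ennreal t \<le> ?s"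
    moreover have "AE x in lebesgue. x \<in> {a<..<b} \<longrightarrow> ennreal (u x) \<le> ?s"
      using esssup_AE[of "\<lambda>x. ennreal (u x)" "lebesgue_on {a<..<b}"]
      unfolding esssup_on_def by (subst (asm) AE_restrict_space_iff) auto
    ultimately have "AE x in lebesgue. x \<in> {a<..<b} \<longrightarrow> ennreal (u x) < ennreal t"
      by (auto elim!: eventually_mono)
    then have "AE x in lebesgue. x \<in> {a<..<b} \<longrightarrow> u x < t"
      by (rule eventually_mono) (metis ennreal_leI linorder_not_le)
    then show False using not_below by simp
  qed
  also have "?s \<le> ennreal c * average {a<..<b} u"
    using c bounded_interval_in_Ioo[OF ab] by (simp add: RHinf_constants_def)
  finally have "ennreal t * ennreal (b - a) \<le> ennreal c * average {a<..<b} u * ennreal (b - a)"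
    by (intro mult_right_mono) auto
  then show ?thesis using ab by (simp add: set_nn_integral_eq_average ennreal_mult'' mult.assoc)
qed

text \<open>
  The essential supremum \<open>M\<close> is finite because averages of a weight are; and \<open>1 \<le> c\<close> because the average
  does not exceed \<open>M\<close>.
\<close>

lemma RHinf_esssup:
  assumes u: "weight_on X u" and c: "c \<in> RHinf_constants X u" and ab: "a < b" "{a<..<b} \<subseteq> X"
  obtains M where "0 < M" "1 \<le> c" "AE x in lebesgue. x \<in> {a<..<b} \<longrightarrow> u x \<le> M"
    "\<And>t. t < M \<Longrightarrow> \<not> (AE x in lebesgue. x \<in> {a<..<b} \<longrightarrow> u x \<le> t)"
proof -
  let ?s = "esssup_on {a<..<b} u"
  obtain m where m: "0 < m" "average {a<..<b} u = ennreal m"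
    using weight_on_average[OF u ab] by blast
  have "?s \<le> ennreal c * average {a<..<b} u"
    using c bounded_interval_in_Ioo[OF ab] by (simp add: RHinf_constants_def)
  then have le: "?s \<le> ennreal c * ennreal m" using m by simp
  then have "?s < top" by (metis ennreal_less_top ennreal_mult_eq_top_iff ennreal_neq_top le_less_trans less_top)
  then obtain M where M: "?s = ennreal M" "0 \<le> M" by (cases ?s) auto
  have AE: "AE x in lebesgue. x \<in> {a<..<b} \<longrightarrow> u x \<le> M"
    using esssup_AE[of "\<lambda>x. ennreal (u x)" "lebesgue_on {a<..<b}"] M
    unfolding esssup_on_def by (subst (asm) AE_restrict_space_iff) auto
  have "average {a<..<b} u \<le> average {a<..<b} (\<lambda>x. M)" by (rule average_mono[OF AE])
  also have "\<dots> \<le> ennreal M"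
    using ab M by (intro average_le) (auto simp: nn_integral_cmult_indicator ennreal_mult)
  finally have mM: "m \<le> M" using m M by simp
  then have "ennreal m \<le> ennreal c * ennreal m" using le M by (metis ennreal_leI order_trans)
  then have "m \<le> max c 0 * m" using m(1) 
    by (metis ennreal_le_iff ennreal_mult ennreal_neg linorder_not_le max.cobounded2 max_def mult_nonneg_nonneg order_less_imp_le ennreal_0)
  then have "1 \<le> c" using m(1) by (auto simp: max_def split: if_splits)
  moreover have "\<not> (AE x in lebesgue. x \<in> {a<..<b} \<longrightarrow> u x \<le> t)" if "t < M" for t
  proof
    assume "AE x in lebesgue. x \<in> {a<..<b} \<longrightarrow> u x \<le> t"
    then have "AE x in lebesgue_on {a<..<b}. ennreal (u x) \<le> ennreal t"
      by (subst AE_restrict_space_iff) (auto elim!: eventually_mono intro: ennreal_leI)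
    then have "?s \<le> ennreal t"
      unfolding esssup_on_def using weight_on_measurable(1)[OF u ab] by (intro esssup_I) auto
    then have "M \<le> max t 0" using M by (metis ennreal_le_iff ennreal_max_0 max.cobounded2 ennreal_eq_0_iff max_def)
    then show False using that mM m(1) by auto
  qed
  ultimately show ?thesis using that[of M] AE mM m(1) by auto
qed

text \<open>
  The sharp \<open>A\<^sub>p\<close> estimate for \<open>u\<close> itself, with its essential supremum in place of its average. Since
  \<open>q = 1 / (p - 1)\<close>, the condition \<open>c * q < q + 1\<close> says \<open>c < p\<close>.
\<close>

lemma RHinf_negative_moment:
  assumes u: "weight_on X u" and c: "c \<in> RHinf_constants X u" and ab: "a < b" "{a<..<b} \<subseteq> X"
    and q: "0 < q" "c * q < q + 1"
  obtains M where "0 < M" "AE x in lebesgue. x \<in> {a<..<b} \<longrightarrow> u x \<le> M"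
    "average {a<..<b} (\<lambda>x. u x powr (- q)) \<le> ennreal ((q + 1) / (q + 1 - c * q) * M powr (- q))"
proof -
  obtain M where M: "0 < M" "1 \<le> c" and bound: "AE x in lebesgue. x \<in> {a<..<b} \<longrightarrow> u x \<le> M"
    and M_least: "\<And>t. t < M \<Longrightarrow> \<not> (AE x in lebesgue. x \<in> {a<..<b} \<longrightarrow> u x \<le> t)"
    using RHinf_esssup[OF u c ab] by metis
  let ?N = "lebesgue_on {a<..<b}"
  have meas: "u \<in> borel_measurable ?N"
    "(\<lambda>x. ennreal (u x) * indicator {a<..<b} x) \<in> borel_measurable lebesgue"
    using weight_on_measurable[OF u ab] by auto
  have sub_sets: "{x \<in> {a<..<b}. u x < t} \<in> sets lebesgue" for t
  proof -
    have "{x \<in> space ?N. u x < t} \<in> sets ?N" using meas(1) by measurable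
    then show ?thesis by (simp add: sets_restrict_space_iff)
  qed
  have sublevel: "ennreal t * emeasure ?N {x \<in> space ?N. u x < t}
        \<le> ennreal c * (\<integral>\<^sup>+x\<in>{x \<in> space ?N. u x < t}. ennreal (u x) \<partial>?N)" if t: "0 < t" "t < M" for t
  proof -
    let ?E = "{x \<in> {a<..<b}. u x < t}"
    have not_below: "\<not> (AE x in lebesgue. x \<in> {a<..<b} \<longrightarrow> u x < t)"
      using M_least[OF t(2)] by (rule contrapos_nn) (auto elim!: eventually_mono)
    have "ennreal t * emeasure lebesgue ?E \<le> ennreal c * (\<integral>\<^sup>+x\<in>?E. ennreal (u x) \<partial>lebesgue)"
    proof (rule sublevel_set_reverse_bound[OF ab(1) _ _ _ meas(2) bound _ not_below refl sub_sets])
      fix \<alpha> \<beta> :: real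
      assume I: "a \<le> \<alpha>" "\<alpha> < \<beta>" "\<beta> \<le> b" "\<not> (AE x in lebesgue. x \<in> {\<alpha><..<\<beta>} \<longrightarrow> u x < t)"
      have "{\<alpha><..<\<beta>} \<subseteq> {a<..<b}" using I by auto
      then show "ennreal (t * (\<beta> - \<alpha>)) \<le> ennreal c * (\<integral>\<^sup>+x\<in>{\<alpha><..<\<beta>}. ennreal (u x) \<partial>lebesgue)"
        using I ab(2) by (intro RHinf_not_below[OF u c]) auto
    qed (use M t in auto)
    moreover have "emeasure ?N ?E = emeasure lebesgue ?E"
      by (subst emeasure_restrict_space) auto
    moreover have "(\<integral>\<^sup>+x\<in>?E. ennreal (u x) \<partial>?N) = (\<integral>\<^sup>+x\<in>?E. ennreal (u x) \<partial>lebesgue)"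
      by (subst nn_integral_restrict_space) (auto intro!: nn_integral_cong simp: indicator_def)
    ultimately show ?thesis by simp
  qed
  have "(\<integral>\<^sup>+x. ennreal (u x powr (- q)) \<partial>?N)
    \<le> ennreal ((q + 1) / (q + 1 - c * q) * M powr (- q)) * emeasure ?N (space ?N)"
  proof (rule sublevel_bound_imp_negative_moment)
    show "finite_measure ?N"
      using ab by (intro finite_measureI) (simp add: emeasure_restrict_space)
    show "AE x in ?N. u x \<le> M" using bound by (subst AE_restrict_space_iff) auto
    show "\<And>x. x \<in> space ?N \<Longrightarrow> 0 < u x" using u ab by (auto simp: weight_on_def)
  qed (use M q meas sublevel in auto)
  also have "emeasure ?N (space ?N) = ennreal (b - a)"
    using ab by (simp add: emeasure_restrict_space)
  also have "(\<integral>\<^sup>+x. ennreal (u x powr (- q)) \<partial>?N) = (\<integral>\<^sup>+x\<in>{a<..<b}. ennreal (u x powr (- q)) \<partial>lebesgue)"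
    by (simp add: nn_integral_restrict_space)
  finally have "average {a<..<b} (\<lambda>x. u x powr (- q)) \<le> ennreal ((q + 1) / (q + 1 - c * q) * M powr (- q))"
    using ab q M by (intro average_le) (auto simp: ennreal_mult''[symmetric])
  then show ?thesis using that M bound by blast
qed

section \<open>Products of \<open>RH\<^bsub>\<infinity>\<^esub>\<close> weights and powers of \<open>A\<^sub>1\<close> weights\<close>

lemma RHinf_A1_product_in_A_class:
  assumes r: "1 < r" and w_eq: "\<And>x. x \<in> X \<Longrightarrow> w x = u x * v x powr (1 / r)"
    and w: "weight_on X w" and u: "u \<in> RHinf_class X" and v: "v \<in> A1_class X"
    and p: "RHinf_const X u < p"
  shows "w \<in> A_class X p"
proof -
  have wu: "weight_on X u" and wv: "weight_on X v"
    using u v by (auto simp: RHinf_class_def A1_class_def)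
  obtain c where c: "c \<in> RHinf_constants X u" "c < p"
    using u p cInf_lessD[of "RHinf_constants X u" p] by (auto simp: RHinf_class_def RHinf_const_def)
  obtain d where d: "0 < d" and v_lower: "\<And>a b m. a < b \<Longrightarrow> {a<..<b} \<subseteq> X \<Longrightarrow>
      average {a<..<b} v = ennreal m \<Longrightarrow> 0 < m \<Longrightarrow> AE x in lebesgue. x \<in> {a<..<b} \<longrightarrow> m / d \<le> v x"
    by (rule A1_lower_bound[OF v]) (rule that, assumption, blast)
  define q where "q = 1 / (p - 1)"
  define K where "K = (q + 1) / (q + 1 - c * q)"
  show ?thesis
  proof (rule A_classI[OF w])
    fix a b :: real assume ab: "a < b" "{a<..<b} \<subseteq> X"
    let ?A = "{a<..<b}"
    have pos: "0 < u x" "0 < v x" "w x = u x * v x powr (1 / r)" if "x \<in> ?A" for x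
      using wu wv ab w_eq that by (auto simp: weight_on_def)
    have c1: "1 \<le> c" using RHinf_esssup[OF wu c(1) ab] by metis
    then have p1: "1 < p" using c by simp
    then have q: "0 < q" "q * (p - 1) = 1" by (simp_all add: q_def)
    have cq: "c * q < q + 1"
      using mult_strict_right_mono[OF c(2) q(1)] q(2) by (simp add: algebra_simps)
    have K: "0 \<le> K" using q cq unfolding K_def by simp
    have exponent: "1 - p / (p - 1) = - q" using p1 by (simp add: q_def field_simps)
    obtain M where M: "0 < M" "AE x in lebesgue. x \<in> ?A \<longrightarrow> u x \<le> M"
      and moment: "average ?A (\<lambda>x. u x powr (- q)) \<le> ennreal (K * M powr (- q))"
      unfolding K_def using RHinf_negative_moment[OF wu c(1) ab q(1) cq] .
    obtain m where m: "0 < m" "average ?A v = ennreal m"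
      "(\<integral>\<^sup>+x\<in>?A. ennreal (v x) \<partial>lebesgue) = ennreal (m * (b - a))"
      using weight_on_average[OF wv ab] .
    define s where "s = m powr (1 / r)"
    have s: "0 < s" using m by (simp add: s_def)
    \<comment> \<open>Instead of Jensen's inequality for the concave power \<open>1 / r\<close>, the bound \<open>y powr (1 / r) \<le> 1 + y\<close>
      at \<open>y = v x / m\<close> suffices, at the price of the factor 2.\<close>
    have "average ?A w \<le> average ?A (\<lambda>x. M * s + M * s / m * v x)"
    proof (rule average_mono)
      show "AE x in lebesgue. x \<in> ?A \<longrightarrow> w x \<le> M * s + M * s / m * v x"
        using M(2)
      proof (rule eventually_mono, intro impI)
        fix x assume "x \<in> ?A \<longrightarrow> u x \<le> M" and x: "x \<in> ?A"
        then have uM: "u x \<le> M" by simp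
        have "(v x / m) powr (1 / r) \<le> 1 + v x / m"
        proof -
          have "(v x / m) powr (1 / r) \<le> (1 + v x / m) powr (1 / r)"
            using r pos[OF x] m by (intro powr_mono2) auto
          also have "\<dots> \<le> (1 + v x / m) powr 1"
            using r pos[OF x] m by (intro powr_mono) auto
          finally show ?thesis using pos[OF x] m by simp
        qed
        then have "s * (v x / m) powr (1 / r) \<le> s * (1 + v x / m)"
          using s by simp
        moreover have "s * (v x / m) powr (1 / r) = v x powr (1 / r)"
          using pos[OF x] m by (simp add: s_def powr_divide)
        ultimately have "u x * v x powr (1 / r) \<le> M * (s * (1 + v x / m))"
          using uM M(1) pos[OF x] by (intro mult_mono) auto
        then show "w x \<le> M * s + M * s / m * v x"
          using pos(3)[OF x] by (simp add: distrib_left mult.assoc)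
      qed
    qed
    also have "\<dots> \<le> ennreal (2 * M * s)"
    proof (rule average_le[OF ab(1)])
      have [simp]: "(\<lambda>x. ennreal (M * s) * indicator ?A x) \<in> borel_measurable lebesgue"
        by (intro measurable_completion) simp
      have "(\<integral>\<^sup>+x\<in>?A. ennreal (M * s + M * s / m * v x) \<partial>lebesgue)
        = (\<integral>\<^sup>+x. ennreal (M * s) * indicator ?A x + ennreal (M * s / m) * (ennreal (v x) * indicator ?A x) \<partial>lebesgue)"
      proof -
        have "ennreal (M * s + M * s / m * y) = ennreal (M * s) + ennreal (M * s / m) * ennreal y" if "0 < y" for y
          using M s m that ennreal_mult[of "M * s / m" y] by simp
        then show ?thesis using pos by (intro nn_integral_cong) (auto simp: indicator_def)
      qed
      also have "\<dots> = ennreal (M * s) * ennreal (b - a) + ennreal (M * s / m) * ennreal (m * (b - a))"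
        using weight_on_measurable(2)[OF wv ab] ab m(3)
        by (subst nn_integral_add) (auto simp: nn_integral_cmult nn_integral_cmult_indicator)
      also have "\<dots> = ennreal (2 * M * s * (b - a))"
        using M s m ab by (subst ennreal_mult[symmetric], simp, simp, subst ennreal_mult[symmetric], simp, simp,
            subst ennreal_plus[symmetric]) (auto simp: field_simps)
      finally show "(\<integral>\<^sup>+x\<in>?A. ennreal (M * s + M * s / m * v x) \<partial>lebesgue) \<le> ennreal (2 * M * s * (b - a))"
        by simp
    qed (use M s in auto)
    finally have avg_w: "average ?A w \<le> ennreal (2 * M * s)" .
    define L where "L = (m / d) powr (- (q / r))"
    have "average ?A (\<lambda>x. w x powr (- q)) \<le> ennreal (L * (K * M powr (- q)))"
    proof -
      have "average ?A (\<lambda>x. w x powr (- q)) \<le> average ?A (\<lambda>x. L * u x powr (- q))"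
      proof (rule average_mono)
        show "AE x in lebesgue. x \<in> ?A \<longrightarrow> w x powr (- q) \<le> L * u x powr (- q)"
          using v_lower[OF ab m(2,1)]
        proof (rule eventually_mono, intro impI)
          fix x assume "x \<in> ?A \<longrightarrow> m / d \<le> v x" and x: "x \<in> ?A"
          then have "v x powr (- (q / r)) \<le> L"
            unfolding L_def using m d q r by (intro powr_mono2') auto
          then show "w x powr (- q) \<le> L * u x powr (- q)"
            using pos[OF x] by (simp add: powr_mult powr_powr mult.commute mult_left_mono)
        qed
      qed
      also have "\<dots> \<le> ennreal (L * (K * M powr (- q)))"
      proof (rule average_le[OF ab(1)])
        have mu: "(\<lambda>x. ennreal (u x powr (- q)) * indicator ?A x) \<in> borel_measurable lebesgue"
          using weight_on_measurable(1)[OF wu ab]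
          by (subst borel_measurable_restrict_space_iff_ennreal[symmetric]) auto
        have "(\<integral>\<^sup>+x\<in>?A. ennreal (L * u x powr (- q)) \<partial>lebesgue)
            = (\<integral>\<^sup>+x. ennreal L * (ennreal (u x powr (- q)) * indicator ?A x) \<partial>lebesgue)"
          by (intro nn_integral_cong) (simp add: ennreal_mult'' mult.assoc)
        also have "\<dots> = ennreal L * (\<integral>\<^sup>+x\<in>?A. ennreal (u x powr (- q)) \<partial>lebesgue)"
          by (rule nn_integral_cmult[OF mu])
        also have "\<dots> \<le> ennreal L * (ennreal (K * M powr (- q)) * ennreal (b - a))"
          unfolding set_nn_integral_eq_average[OF ab(1)]
          by (intro mult_left_mono mult_right_mono moment) auto
        also have "\<dots> = ennreal (L * (K * M powr (- q)) * (b - a))"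
          using K ab by (simp add: L_def ennreal_mult[symmetric] mult.assoc)
        finally show "(\<integral>\<^sup>+x\<in>?A. ennreal (L * u x powr (- q)) \<partial>lebesgue) \<le> ennreal (L * (K * M powr (- q)) * (b - a))" .
      qed (use K in \<open>simp add: L_def\<close>)
      finally show ?thesis .
    qed
    then have "ennreal_powr (average ?A (\<lambda>x. w x powr (- q))) (p - 1)
        \<le> ennreal ((L * (K * M powr (- q))) powr (p - 1))"
      using K p1 by (intro ennreal_powr_le) (auto simp: L_def)
    also have "(L * (K * M powr (- q))) powr (p - 1) = L powr (p - 1) * K powr (p - 1) / M"
    proof -
      have "- q * (p - 1) = - 1" using q(2) by (simp add: minus_mult_left[symmetric] del: mult_minus_left)
      then have "(M powr (- q)) powr (p - 1) = 1 / M"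
        using M by (simp only: powr_powr) (simp add: powr_minus_divide)
      moreover have "0 \<le> L" by (simp add: L_def)
      ultimately show ?thesis using K by (simp add: powr_mult)
    qed
    also have "L powr (p - 1) = d powr (1 / r) / s"
    proof -
      have "- (q / r) * (p - 1) = - (1 / r)" using q(2) by simp
      then have "L powr (p - 1) = (m / d) powr (- (1 / r))"
        unfolding L_def by (simp only: powr_powr)
      then show ?thesis
        using m d by (simp add: s_def powr_minus powr_divide)
    qed
    finally have avg_dual: "ennreal_powr (average ?A (\<lambda>x. w x powr (1 - p / (p - 1)))) (p - 1)
        \<le> ennreal (d powr (1 / r) / s * K powr (p - 1) / M)"
      by (simp only: exponent)
    \<comment> \<open>The quantities \<open>M\<close> and \<open>s\<close>, which depend on the interval, cancel.\<close>
    have "average ?A w * ennreal_powr (average ?A (\<lambda>x. w x powr (1 - p / (p - 1)))) (p - 1)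
        \<le> ennreal (2 * M * s) * ennreal (d powr (1 / r) / s * K powr (p - 1) / M)"
      by (intro mult_mono avg_w avg_dual) auto
    also have "\<dots> = ennreal (2 * d powr (1 / r) * K powr (p - 1))"
      using M s by (simp add: ennreal_mult[symmetric])
    finally show "average ?A w * ennreal_powr (average ?A (\<lambda>x. w x powr (1 - p / (p - 1)))) (p - 1)
        \<le> ennreal (2 * d powr (1 / r) * K powr (p - 1))" .
  qed
qed

section \<open>Power weights on the half-line\<close>

lemma const_one_in_A1_class: "(\<lambda>_. 1) \<in> A1_class X"
proof -
  have "weight_on X (\<lambda>_. 1)"
  proof -
    have "set_integrable lebesgue I (\<lambda>_. 1 :: real)" if I: "bounded_interval_in X I" for I
    proof -
      obtain a b where ab: "I \<subseteq> {a..b}" "I \<in> sets lebesgue"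
        using bounded_interval_inE[OF I] by metis
      have "set_integrable lebesgue {a..b} (\<lambda>_. 1 :: real)"
        by (intro absolutely_integrable_continuous_real) simp
      then show ?thesis using ab set_integrable_subset by blast
    qed
    then show ?thesis by (simp add: weight_on_def)
  qed
  moreover have "average I (\<lambda>_. 1) \<le> ennreal 1 * essinf_on I (\<lambda>_. 1)" if I: "bounded_interval_in X I" for I
  proof -
    obtain a b where ab: "a < b" "{a<..<b} \<subseteq> I" "I \<subseteq> {a..b}" "I \<in> sets lebesgue" "I \<subseteq> X"
      using bounded_interval_inE[OF I] .
    have "average I (\<lambda>_. 1) \<le> ennreal 1"
      unfolding average_interior[OF ab(2-4)] using ab(1) by (intro average_le) auto
    moreover have "1 \<le> essinf_on I (\<lambda>_. 1)"
      by (auto simp: essinf_on_def essinf_def intro: Liminf_bounded)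
    ultimately show ?thesis by (auto intro: order_trans)
  qed
  ultimately show ?thesis unfolding A1_class_def by blast
qed

text \<open>
  On \<open>(exp (- n), 1)\<close> the integral of \<open>1 / x\<close> is \<open>n\<close>.
\<close>

lemma set_nn_integral_inverse_powr_eq_top:
  fixes s :: real
  assumes "1 \<le> s"
  shows "(\<integral>\<^sup>+x\<in>{0<..<1}. ennreal (x powr (- s)) \<partial>lebesgue) = top"
proof (rule ccontr)
  let ?J = "\<integral>\<^sup>+x\<in>{0<..<1}. ennreal (x powr (- s)) \<partial>lebesgue"
  have ge: "ennreal (real n) \<le> ?J" for n
  proof -
    have "(\<integral>\<^sup>+x. ennreal (inverse x) * indicator {exp (- real n)..1} x \<partial>lborel) = ennreal (ln 1 - ln (exp (- real n)))"
    proof (rule nn_integral_FTC_Icc)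
      fix x assume "x \<in> {exp (- real n)..1}"
      then have x: "0 < x" using less_le_trans[OF exp_gt_zero[of "- real n"]] by auto
      then show "(ln has_real_derivative inverse x) (at x)" by (rule DERIV_ln)
      show "0 \<le> inverse x" using x by simp
    qed auto
    then have "ennreal (real n) = (\<integral>\<^sup>+x. ennreal (inverse x) * indicator {exp (- real n)..1} x \<partial>lborel)" by simp
    also have "\<dots> \<le> (\<integral>\<^sup>+x. ennreal (x powr (- s)) * indicator {0<..<1} x \<partial>lborel)"
    proof (rule nn_integral_mono_AE)
      show "AE x in lborel. ennreal (inverse x) * indicator {exp (- real n)..1} x \<le> ennreal (x powr (- s)) * indicator {0<..<1} x"
        using AE_lborel_singleton[of 1]
      proof (rule eventually_mono)
        fix x :: real assume "x \<noteq> 1"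
        moreover have "inverse x \<le> x powr (- s)" if "0 < x" "x < 1"
        proof -
          have "x powr (- 1) \<le> x powr (- s)" using that assms by (intro powr_mono') auto
          then show ?thesis using that by (simp add: powr_minus)
        qed
        moreover have "0 < x" if "exp (- real n) \<le> x" using that exp_gt_zero[of "- real n"] by linarith
        ultimately show "ennreal (inverse x) * indicator {exp (- real n)..1} x \<le> ennreal (x powr (- s)) * indicator {0<..<1} x"
          by (auto simp: indicator_def intro: ennreal_leI)
      qed
    qed
    finally show ?thesis by (simp add: nn_integral_completion)
  qed
  assume "?J \<noteq> top"
  then obtain j where j: "?J = ennreal j" "0 \<le> j" by (cases ?J) auto
  obtain n where "j < real n" using reals_Archimedean2 by blast
  then show False using ge[of n] j by simp
qed

context
  fixes c :: real
  assumes c: "1 < c"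
begin

lemma continuous_on_power_weight: "0 \<le> a \<Longrightarrow> continuous_on {a..b} (\<lambda>x::real. x powr (c - 1))"
  using c by (intro continuous_on_powr') (auto intro!: continuous_intros)

lemma power_weight_integral:
  assumes ab: "0 \<le> a" "a < b"
  shows "(\<integral>\<^sup>+x\<in>{a<..<b}. ennreal (x powr (c - 1)) \<partial>lebesgue) = ennreal ((b powr c - a powr c) / c)"
proof -
  have "((\<lambda>x. x powr (c - 1)) has_integral (b powr c / c - a powr c / c)) {a..b}"
  proof (rule fundamental_theorem_of_calculus_interior)
    show "continuous_on {a..b} (\<lambda>x. x powr c / c)"
      using ab c by (intro continuous_intros continuous_on_powr') auto
    fix x assume "x \<in> {a<..<b}"
    then show "((\<lambda>x. x powr c / c) has_vector_derivative x powr (c - 1)) (at x)"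
      unfolding has_real_derivative_iff_has_vector_derivative[symmetric]
      using ab c by (auto intro!: derivative_eq_intros)
  qed (use ab in auto)
  then have "((\<lambda>x. x powr (c - 1)) has_integral (b powr c - a powr c) / c) {a<..<b}"
    by (simp only: has_integral_Icc_iff_Ioo diff_divide_distrib)
  then have "(\<integral>\<^sup>+x. ennreal (x powr (c - 1)) * indicator {a<..<b} x \<partial>lborel) = ennreal ((b powr c - a powr c) / c)"
    by (intro nn_integral_has_integral_lebesgue') auto
  then show ?thesis by (simp add: nn_integral_completion)
qed

lemma power_weight_on: "weight_on {0<..} (\<lambda>x. x powr (c - 1))"
proof -
  have "set_integrable lebesgue I (\<lambda>x. x powr (c - 1))" if I: "bounded_interval_in {0<..} I" for I
  proof -
    obtain a b where ab: "a < b" "{a<..<b} \<subseteq> I" "I \<subseteq> {a..b}" "I \<in> sets lebesgue" "I \<subseteq> {0<..}"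
      using bounded_interval_inE[OF I] .
    have "set_integrable lebesgue {0..b} (\<lambda>x. x powr (c - 1))"
      by (intro absolutely_integrable_continuous_real continuous_on_power_weight) simp
    moreover have "I \<subseteq> {0..b}" using ab(3,5) by fastforce
    ultimately show ?thesis using ab(4) set_integrable_subset by blast
  qed
  then show ?thesis by (auto simp: weight_on_def)
qed

text \<open>
  If \<open>\<beta>\<close> is the right endpoint of \<open>I\<close> and \<open>\<alpha>\<close> the left one, the bound \<open>b\<close> is \<open>\<beta> powr (c - 1)\<close>, and the
  inequality with the average amounts to \<open>\<alpha> powr c \<le> \<alpha> * \<beta> powr (c - 1)\<close>.
\<close>

lemma power_weight_average_bound:
  assumes I: "bounded_interval_in {0<..} I"
  obtains b where "0 < b" "\<And>x. x \<in> I \<Longrightarrow> 0 < x \<and> x powr (c - 1) \<le> b"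
    "ennreal b \<le> ennreal c * average I (\<lambda>x. x powr (c - 1))" "I \<in> sets lebesgue"
proof -
  obtain a b where ab: "a < b" "{a<..<b} \<subseteq> I" "I \<subseteq> {a..b}" "I \<in> sets lebesgue" "I \<subseteq> {0<..}"
    using bounded_interval_inE[OF I] .
  have a0: "0 \<le> a"
  proof (rule ccontr)
    assume "\<not> 0 \<le> a"
    then obtain x where "a < x" "x < min b 0" using dense[of a "min b 0"] ab(1) by auto
    then have "x \<in> {a<..<b}" "x < 0" by auto
    then show False using ab(2,5) by force
  qed
  then have b0: "0 < b" using ab by simp
  have "a powr c \<le> a * b powr (c - 1)"
  proof (cases "a = 0")
    case False
    then have "a powr c = a * a powr (c - 1)" using a0 by (simp add: powr_diff)
    also have "\<dots> \<le> a * b powr (c - 1)" using a0 ab c by (intro mult_left_mono powr_mono2) auto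
    finally show ?thesis .
  qed simp
  moreover have "b powr c = b * b powr (c - 1)" using b0 by (simp add: powr_diff)
  ultimately have num: "b powr (c - 1) * (b - a) \<le> b powr c - a powr c"
    by (simp add: algebra_simps)
  show ?thesis
  proof (rule that[of "b powr (c - 1)"])
    show "0 < b powr (c - 1)" using b0 by simp
    show "0 < x \<and> x powr (c - 1) \<le> b powr (c - 1)" if "x \<in> I" for x
      using that ab c by (auto intro!: powr_mono2)
    have "average I (\<lambda>x. x powr (c - 1)) = ennreal ((b powr c - a powr c) / c / (b - a))"
    proof -
      have "0 \<le> (b powr c - a powr c) / c" using a0 ab c by (auto intro!: divide_nonneg_pos powr_mono2)
      then show ?thesis
        using a0 ab by (simp add: average_interior[OF ab(2-4)] average_Ioo power_weight_integral divide_ennreal)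
    qed
    moreover have "b powr (c - 1) \<le> c * ((b powr c - a powr c) / c / (b - a))"
      using num ab c by (simp add: pos_le_divide_eq)
    ultimately show "ennreal (b powr (c - 1)) \<le> ennreal c * average I (\<lambda>x. x powr (c - 1))"
      using c by (simp add: ennreal_mult'[symmetric] ennreal_leI)
  qed (use ab in auto)
qed

lemma power_weight_RHinf_constant: "c \<in> RHinf_constants {0<..} (\<lambda>x. x powr (c - 1))"
proof -
  have "esssup_on I (\<lambda>x. x powr (c - 1)) \<le> ennreal c * average I (\<lambda>x. x powr (c - 1))"
    if I: "bounded_interval_in {0<..} I" for I
  proof -
    obtain b where b: "0 < b" "\<And>x. x \<in> I \<Longrightarrow> 0 < x \<and> x powr (c - 1) \<le> b"
      "ennreal b \<le> ennreal c * average I (\<lambda>x. x powr (c - 1))" "I \<in> sets lebesgue"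
      by (rule power_weight_average_bound[OF I]) (rule that, assumption, blast)
    have "esssup_on I (\<lambda>x. x powr (c - 1)) \<le> ennreal b"
      unfolding esssup_on_def
    proof (rule esssup_I)
      have "(\<lambda>x. ennreal (x powr (c - 1))) \<in> borel_measurable lebesgue"
        by (intro measurable_completion) simp
      then show "(\<lambda>x. ennreal (x powr (c - 1))) \<in> borel_measurable (lebesgue_on I)"
        by (rule measurable_restrict_space1)
      show "AE x in lebesgue_on I. ennreal (x powr (c - 1)) \<le> ennreal b"
        using b by (intro AE_I2 ennreal_leI) auto
    qed
    also note b(3)
    finally show ?thesis .
  qed
  then show ?thesis by (simp add: RHinf_constants_def)
qed

text \<open>
  On \<open>(0, 1)\<close> the essential supremum is \<open>1\<close> and the average \<open>1 / c\<close>, so no smaller constant works.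
\<close>

lemma power_weight_RHinf_const: "RHinf_const {0<..} (\<lambda>x. x powr (c - 1)) = c"
  unfolding RHinf_const_def
proof (rule cInf_eq_minimum[OF power_weight_RHinf_constant])
  fix c' assume c': "c' \<in> RHinf_constants {0<..} (\<lambda>x. x powr (c - 1))"
  have "t * c \<le> c'" if t: "0 < t" "t < 1" for t
  proof -
    define z where "z = t powr (1 / (c - 1))"
    have z: "0 < z" "z < 1" "z powr (c - 1) = t"
      using t c powr_less_mono2[of "1 / (c - 1)" t 1] by (auto simp: z_def powr_powr)
    have "\<not> (AE x in lebesgue. x \<in> {0<..<1} \<longrightarrow> x powr (c - 1) < t)"
    proof
      assume "AE x in lebesgue. x \<in> {0<..<1} \<longrightarrow> x powr (c - 1) < t"
      then have "AE x in lebesgue. x \<notin> {z<..<1}"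
      proof (rule eventually_mono, intro notI)
        fix x assume "x \<in> {0<..<1} \<longrightarrow> x powr (c - 1) < t" "x \<in> {z<..<1}"
        moreover have "z powr (c - 1) \<le> x powr (c - 1)" if "z < x" using that z c by (intro powr_mono2) auto
        ultimately show False using z by auto
      qed
      then have "emeasure lebesgue {z<..<1} = 0"
        by (subst AE_iff_measurable[symmetric, where P="\<lambda>x. x \<notin> {z<..<1}"]) auto
      then show False using z by simp
    qed
    from RHinf_not_below[OF power_weight_on c' _ _ this]
    have "ennreal t \<le> ennreal c' * ennreal (1 / c)"
      using power_weight_integral[of 0 1] by (auto simp: subset_eq)
    then have *: "ennreal t \<le> ennreal (c' * (1 / c))" using c ennreal_mult''[of "1 / c" c'] by simp
    then have "t \<le> c' * (1 / c)" using t by (metis ennreal_le_iff2 linorder_not_le)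
    then show ?thesis using c by (simp add: field_simps)
  qed
  then show "c \<le> c'" by (rule field_le_mult_one_interval)
qed

text \<open>
  Every average is at most the supremum, which \<open>RH\<^bsub>\<infinity>\<^esub>\<close> compares with the average of the weight.
\<close>

lemma power_weight_in_RH_class:
  assumes r: "1 < r"
  shows "(\<lambda>x. x powr (c - 1)) \<in> RH_class {0<..} r"
proof -
  have "ennreal_powr (average I (\<lambda>x. (x powr (c - 1)) powr r)) (1 / r) \<le> ennreal c * average I (\<lambda>x. x powr (c - 1))"
    if I: "bounded_interval_in {0<..} I" for I
  proof -
    obtain b where b: "0 < b" "\<And>x. x \<in> I \<Longrightarrow> 0 < x \<and> x powr (c - 1) \<le> b"
      "ennreal b \<le> ennreal c * average I (\<lambda>x. x powr (c - 1))"
      using power_weight_average_bound[OF I] by metis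
    obtain \<alpha> \<beta> where ab: "\<alpha> < \<beta>" "{\<alpha><..<\<beta>} \<subseteq> I" "I \<subseteq> {\<alpha>..\<beta>}" "I \<in> sets lebesgue"
      using bounded_interval_inE[OF I] by metis
    have "average I (\<lambda>x. (x powr (c - 1)) powr r) \<le> average I (\<lambda>x. b powr r)"
      using b r by (intro average_mono AE_I2 impI powr_mono2) auto
    also have "\<dots> \<le> ennreal (b powr r)"
      unfolding average_interior[OF ab(2-4)] using ab(1)
      by (intro average_le) (auto simp: nn_integral_cmult_indicator ennreal_mult)
    finally have "ennreal_powr (average I (\<lambda>x. (x powr (c - 1)) powr r)) (1 / r) \<le> ennreal ((b powr r) powr (1 / r))"
      using r by (intro ennreal_powr_le) auto
    also have "(b powr r) powr (1 / r) = b" using b r by (simp add: powr_powr)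
    also note b(3)
    finally show ?thesis .
  qed
  then show ?thesis using power_weight_on by (auto simp: RH_class_def)
qed

text \<open>
  The dual weight has exponent \<open>- (c - 1) / (p - 1) \<le> - 1\<close>, so its average over \<open>(0, 1)\<close> is infinite.
\<close>

lemma power_weight_notin_A_class:
  assumes p: "1 < p" "p \<le> c"
  shows "(\<lambda>x. x powr (c - 1)) \<notin> A_class {0<..} p"
proof
  assume "(\<lambda>x. x powr (c - 1)) \<in> A_class {0<..} p"
  moreover have "bounded_interval_in {0<..} {0<..<1::real}"
    by (rule bounded_interval_in_Ioo) auto
  ultimately obtain C where C: "average {0<..<1} (\<lambda>x. x powr (c - 1)) *
      ennreal_powr (average {0<..<1} (\<lambda>x. (x powr (c - 1)) powr (1 - p / (p - 1)))) (p - 1) \<le> ennreal C"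
    unfolding A_class_def by blast
  define s where "s = (c - 1) / (p - 1)"
  have s: "1 \<le> s" "(c - 1) * (1 - p / (p - 1)) = - s"
    using p by (auto simp: s_def field_simps)
  have "average {0<..<1} (\<lambda>x. (x powr (c - 1)) powr (1 - p / (p - 1))) = top"
    using s by (simp add: average_Ioo powr_powr set_nn_integral_inverse_powr_eq_top divide_ennreal_def)
  moreover have "average {0<..<1} (\<lambda>x. x powr (c - 1)) = ennreal (1 / c)"
    using power_weight_integral[of 0 1] by (simp add: average_Ioo divide_ennreal_def)
  ultimately show False using C c by (simp add: ennreal_powr_def ennreal_mult_top top_unique)
qed

end

theorem theorem3:
  shows "(\<forall>(r::real) (u::real \<Rightarrow> real) v w c\<^sub>1.
            1 < r \<and> (\<forall>x. w x = u x * v x powr (1 / r)) \<and> w \<in> RH_class UNIV r \<and>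
            u \<in> RHinf_class UNIV \<and> v \<in> A1_class UNIV \<and> c\<^sub>1 = RHinf_const UNIV u
            \<longrightarrow> (\<forall>p>c\<^sub>1. w \<in> A_class UNIV p))
       \<and> (\<forall>(r::real) (c\<^sub>1::real). 1 < r \<and> 1 < c\<^sub>1 \<longrightarrow>
            (\<exists>(u::real \<Rightarrow> real) v w.
               u \<in> RHinf_class {0<..} \<and> v \<in> A1_class {0<..} \<and>
               RHinf_const {0<..} u = c\<^sub>1 \<and>
               (\<forall>x>0. w x = u x * v x powr (1 / r)) \<and> w \<in> RH_class {0<..} r \<and>
               (\<forall>p. 1 < p \<and> p \<le> c\<^sub>1 \<longrightarrow> w \<notin> A_class {0<..} p)))"
proof (intro conjI allI impI)
  fix r c\<^sub>1 p :: real and u v w :: "real \<Rightarrow> real"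
  assume "1 < r \<and> (\<forall>x. w x = u x * v x powr (1 / r)) \<and> w \<in> RH_class UNIV r \<and>
    u \<in> RHinf_class UNIV \<and> v \<in> A1_class UNIV \<and> c\<^sub>1 = RHinf_const UNIV u" and "c\<^sub>1 < p"
  then show "w \<in> A_class UNIV p"
    by (intro RHinf_A1_product_in_A_class[of r UNIV w u v p]) (auto simp: RH_class_def)
next
  fix r c\<^sub>1 :: real
  assume rc: "1 < r \<and> 1 < c\<^sub>1"
  let ?u = "\<lambda>x::real. x powr (c\<^sub>1 - 1)"
  have "?u \<in> RHinf_class {0<..}"
    using rc power_weight_on power_weight_RHinf_constant by (auto simp: RHinf_class_def)
  then show "\<exists>(u::real \<Rightarrow> real) v w.
               u \<in> RHinf_class {0<..} \<and> v \<in> A1_class {0<..} \<and>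
               RHinf_const {0<..} u = c\<^sub>1 \<and>
               (\<forall>x>0. w x = u x * v x powr (1 / r)) \<and> w \<in> RH_class {0<..} r \<and>
               (\<forall>p. 1 < p \<and> p \<le> c\<^sub>1 \<longrightarrow> w \<notin> A_class {0<..} p)"
    using rc const_one_in_A1_class power_weight_RHinf_const power_weight_in_RH_class power_weight_notin_A_class
    by (intro exI[of _ ?u] exI[of _ "\<lambda>_. 1"]) auto
qed

end
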